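(* Assume the setting and notation described in the context, and assume moreover that $N=2$ and $t=e-1=3$. Then $\mathcal{C}_{(a_1,a_2,a_3)}$ is an $[n,3m]$ cyclic code over $\mathbb{F}_q$ with minimal Hamming distance $d=\frac{(q-1)(r-\sqrt r)}{2q\delta}$, and it has at most $12$ distinct nonzero weights. In each case below the weight $0$ occurs once, and the nonzero weights occur with the listed frequencies (if two listed weights coincide, their frequencies are added). (i) If $2\mid a$: weight $\frac{q-1}{2\delta q}(r+\sqrt r)$ and weight $\frac{q-1}{2\delta q}(r-\sqrt r)$ each occur $3(r-1)$ times; $\frac{3(q-1)}{4\delta q}(r+\sqrt r)$ and $\frac{3(q-1)}{4\delta q}(r-\sqrt r)$ each occur $(r-1)(r-5)/2$ times; $\frac{q-1}{4\delta q}(3r+\sqrt r)$ and $\frac{q-1}{4\delta q}(3r-\sqrt r)$ each occur $3(r-1)^2/2$ times; $\frac{q-1}{\delta q}(r+\sqrt r)$ and $\frac{q-1}{\delta q}(r-\sqrt r)$ each occur $(r-1)(r^2-2r+9)/16$ times; $\frac{q-1}{2\delta q}(2r+\sqrt r)$ and $\frac{q-1}{2\delta q}(2r-\sqrt r)$ each occur $(r-1)(r^2-4r+3)/4$ times; $\frac{q-1}{\delta q}r$ occurs $3(r-1)^3/8$ times. (ii) If $2\nmid a$: weight $\frac{q-1}{2\delta q}(r+\sqrt r)$ and weight $\frac{q-1}{2\delta q}(r-\sqrt r)$ each occur $r-1$ times; $\frac{q-1}{2\delta q}r$ occurs $4(r-1)$ times; $\frac{3(q-1)}{4\delta q}(r+\sqrt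 r)$ and $\frac{3(q-1)}{4\delta q}(r-\sqrt r)$ each occur $(r-1)^2/2$ times; $\frac{q-1}{4\delta q}(3r+\sqrt r)$ and $\frac{q-1}{4\delta q}(3r-\sqrt r)$ each occur $(r-1)(3r-7)/2$ times; $\frac{q-1}{\delta q}(r+\sqrt r)$ and $\frac{q-1}{\delta q}(r-\sqrt r)$ each occur $(r-1)^3/16$ times; $\frac{q-1}{2\delta q}(2r+\sqrt r)$ and $\frac{q-1}{2\delta q}(2r-\sqrt r)$ each occur $(r-1)(r^2-4r+3)/4$ times; $\frac{q-1}{\delta q}r$ occurs $(r-1)(3r^2-6r+11)/8$ times.
   Context: Let $p$ be a prime, $s,m\ge 1$ integers, $q=p^s$, $r=q^m$, and let $\gamma$ be a generator of $\mathbb{F}_r^*$. Let $e\ge t\ge 2$ be integers with $e\mid(r-1)$, let $a$ be an integer with $a\not\equiv 0\pmod{r-1}$, and let $\Delta_1,\ldots,\Delta_t$ be integers, pairwise incongruent modulo $e$, with $\gcd(\Delta_2-\Delta_1,\ldots,\Delta_t-\Delta_1,e)=1$. Let $a_i\equiv a+\frac{r-1}{e}\Delta_i\pmod{r-1}$ for $1\le i\le t$. Assume that the minimal polynomials $h_{a_i}(x)$ of $\gamma^{-a_i}$ over $\mathbb{F}_q$ all have degree $m$ and are pairwise distinct. Put $N=\gcd\!\left(\frac{r-1}{q-1},ae\right)$, $\delta=\gcd(r-1,a_1,\ldots,a_t)$ and $n=\frac{r-1}{\delta}$. The code is $$\mathcal{C}_{(a_1,\ldots,a_t)}=\left\{\left(\mathrm{Tr}_{r/q}\Big(\sum_{j=1}^t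 x_j\gamma^{a_j i}\Big)\right)_{i=0}^{n-1} : x_1,\ldots,x_t\in\mathbb{F}_r\right\},$$ where $\mathrm{Tr}_{r/q}$ is the trace map from $\mathbb{F}_r$ to $\mathbb{F}_q$. *)

theory Defs
  imports
    Complex_Main
    "HOL-Library.Cardinality"
    "HOL-Number_Theory.Cong"
    "Jordan_Normal_Form.VS_Connect"
begin

text \<open>
  The extension of finite fields \<open>F\<^sub>r / F\<^sub>q\<close> is represented by two finite field types
  \<open>'k\<close> (with \<open>q\<close> elements) and \<open>'f\<close> (with \<open>r\<close> elements) and a field homomorphism
  \<open>emb :: 'k \<Rightarrow> 'f\<close>, which is automatically injective.
\<close>

text \<open>
  The sum of conjugates lies in the range of \<open>emb\<close> when \<open>CARD('f) = CARD('k) ^ m\<close>;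
  \<open>inv_into UNIV emb\<close> reads it as an element of the base field.
\<close>
definition field_trace :: "('k::{field,finite} \<Rightarrow> 'f::{field,finite}) \<Rightarrow> nat \<Rightarrow> 'f \<Rightarrow> 'k" where
  "field_trace emb m x = inv_into UNIV emb (\<Sum>k<m. x ^ (CARD('k) ^ k))"

definition is_min_poly :: "('k::field \<Rightarrow> 'f::field) \<Rightarrow> 'f \<Rightarrow> 'k poly \<Rightarrow> bool" where
  "is_min_poly emb \<alpha> h \<longleftrightarrow>
     lead_coeff h = 1 \<and> poly (map_poly emb h) \<alpha> = 0 \<and>
     (\<forall>g. g \<noteq> 0 \<and> poly (map_poly emb g) \<alpha> = 0 \<longrightarrow> degree h \<le> degree g)"

definition min_poly :: "('k::field \<Rightarrow> 'f::field) \<Rightarrow> 'f \<Rightarrow> 'k poly" where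
  "min_poly emb \<alpha> = (THE h. is_min_poly emb \<alpha> h)"

definition hamming_weight :: "'k::zero vec \<Rightarrow> nat" where
  "hamming_weight v = card {i. i < dim_vec v \<and> v $ i \<noteq> 0}"

definition hamming_distance :: "'k vec \<Rightarrow> 'k vec \<Rightarrow> nat" where
  "hamming_distance u v = card {i. i < dim_vec u \<and> u $ i \<noteq> v $ i}"

definition min_distance :: "'k vec set \<Rightarrow> nat" where
  "min_distance C = Min {hamming_distance u v | u v. u \<in> C \<and> v \<in> C \<and> u \<noteq> v}"

definition linear_code :: "nat \<Rightarrow> nat \<Rightarrow> 'k::field vec set \<Rightarrow> bool" where
  "linear_code n k C \<longleftrightarrow>
     VectorSpace.subspace class_ring C (module_vec TYPE('k) n) \<and>
     vectorspace.dim class_ring ((module_vec TYPE('k) n)\<lparr>carrier := C\<rparr>) = k"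

text \<open>Closed under \<open>(c\<^sub>0, \<dots>, c\<^sub>n\<^sub>-\<^sub>1) \<mapsto> (c\<^sub>n\<^sub>-\<^sub>1, c\<^sub>0, \<dots>, c\<^sub>n\<^sub>-\<^sub>2)\<close>.\<close>
definition cyclic_code :: "nat \<Rightarrow> nat \<Rightarrow> 'k::field vec set \<Rightarrow> bool" where
  "cyclic_code n k C \<longleftrightarrow>
     linear_code n k C \<and> (\<forall>c\<in>C. vec n (\<lambda>i. c $ ((i + n - 1) mod n)) \<in> C)"

text \<open>
  A table lists pairs of a weight and a frequency; frequencies of coinciding weights are added,
  and a value that is not listed is not the weight of any codeword.
\<close>
definition weight_distribution :: "'k::zero vec set \<Rightarrow> (real \<times> real) list \<Rightarrow> bool" where
  "weight_distribution C tbl \<longleftrightarrow>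
     (\<forall>w. real (card {c \<in> C. real (hamming_weight c) = w}) =
          (\<Sum>(w', f)\<leftarrow>tbl. if w' = w then f else 0))"

definition trace_code ::
  "('k::{field,finite} \<Rightarrow> 'f::{field,finite}) \<Rightarrow> nat \<Rightarrow> 'f \<Rightarrow> nat \<Rightarrow> nat \<Rightarrow> (nat \<Rightarrow> int) \<Rightarrow> 'k vec set"
where
  "trace_code emb m \<gamma> n t b =
     {vec n (\<lambda>i. field_trace emb m (\<Sum>j=1..t. x j * \<gamma> powi (b j * int i))) | x :: nat \<Rightarrow> 'f. True}"

end

theory Submission
  imports Defs "HOL-Number_Theory.Residues"
begin

text \<open>
  For \<open>y \<noteq> 0\<close> the number of squares \<open>z\<close> with \<open>Tr (y z) \<noteq> 0\<close> depends only on the quadratic class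
  of \<open>y\<close>; the first two moments over \<open>y\<close> show that it equals \<open>(q - 1) (r \<plusminus> \<surd>r) / (2 q)\<close>. The sign is
  not determined this way, but the weight distribution is symmetric in it. Splitting the index
  of a codeword modulo 4 expresses its weight by these numbers at four values \<open>y\<^sub>0, \<dots>, y\<^sub>3\<close>, because
  the powers of \<open>\<gamma>\<^bsup>4a\<^esup>\<close> together with \<open>F\<^sub>q\<close> generate exactly the squares (this is \<open>N = 2\<close>).
  As \<open>(x\<^sub>1, x\<^sub>2, x\<^sub>3)\<close> varies, the \<open>y\<^sub>h\<close>, up to factors of known class, run through all quadruples with
  sum zero: they are a discrete Fourier transform of length 4 with one frequency missing.
  The frequencies then follow from the cyclotomic numbers of order 2.
\<close>

section \<open>The trace of a finite field extension\<close>

text \<open>Squares are a workable index set because \<open>N = 2\<close> makes (r - 1)/(q - 1)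
  even: every nonzero element of F_q is then a square in F_r, and the squares form a union of
  F_q-lines with 0 removed. Squares on one line have the same trace kernel, squares on different
  lines have independent ones, and counting these kernels gives the second moment without any Gauss
  sum. The factor between the h-th value and the h-th Fourier coefficient is \<gamma>^(a h) times a
  fourth root of unity. The root does not change quadratic classes, since 4 | r - 1 and the even
  index force r \<equiv> 1 (mod 8). So the class of the factor is governed by the parity of a h,
  which is the origin of the two cases. Four values with sum zero cannot have exactly one nonzero
  entry. Hence a nonzero triple gives at least two nonzero values, and the resulting lower bound on
  weights yields both the minimum distance and the injectivity of the encoding; the dimension
  follows by counting codewords.\<close>

lemma finite_field_power_card:
  fixes x :: "'a::{field,finite}"
  shows "x ^ CARD('a) = x"
proof (cases "x = 0")
  case True
  then show ?thesis by (simp add: power_0_left)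
next
  case False
  define P where "P = (\<Prod>y\<in>UNIV - {0::'a}. y)"
  have "P \<noteq> 0" by (simp add: P_def)
  have "P = (\<Prod>y\<in>UNIV - {0::'a}. x * y)"
    unfolding P_def
    by (rule prod.reindex_bij_witness[where i = "\<lambda>y. x * y" and j = "\<lambda>y. y / x"])
       (use False in auto)
  also have "\<dots> = x ^ card (UNIV - {0::'a}) * P"
    by (simp add: prod.distrib P_def)
  finally have "x ^ (CARD('a) - 1) = 1"
    using \<open>P \<noteq> 0\<close> by (simp add: card_Diff_singleton)
  moreover have "CARD('a) = Suc (CARD('a) - 1)" by simp
  ultimately show ?thesis by (metis mult.right_neutral power_Suc)
qed

lemma card_eq_sum_fibres:
  fixes f :: "'a::finite \<Rightarrow> 'b::finite"
  shows "CARD('a) = (\<Sum>c\<in>UNIV. card {x. f x = c})"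
  using sum.group[of "UNIV::'a set" "UNIV::'b set" f "\<lambda>_. 1::nat"] by simp

lemma sum_card_swap:
  assumes "finite A" "finite B"
  shows "(\<Sum>x\<in>A. card {y\<in>B. P x y}) = (\<Sum>y\<in>B. card {x\<in>A. P x y})"
proof -
  have "(\<Sum>x\<in>A. card {y\<in>B. P x y}) = (\<Sum>x\<in>A. \<Sum>y\<in>B. if P x y then 1 else 0)"
    using assms by (simp add: sum.If_cases Int_def)
  also have "\<dots> = (\<Sum>y\<in>B. \<Sum>x\<in>A. if P x y then 1 else 0)" by (rule sum.swap)
  also have "\<dots> = (\<Sum>y\<in>B. card {x\<in>A. P x y})"
    using assms by (simp add: sum.If_cases Int_def)
  finally show ?thesis .
qed

locale finite_extension = field_hom emb
  for emb :: "'k::{field,finite} \<Rightarrow> 'f::{field,finite}" +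
  fixes p s m q r :: nat
  assumes prime_p: "prime p" and m_pos: "m \<ge> 1"
    and q_eq: "q = p ^ s" and r_eq: "r = q ^ m"
    and card_base: "CARD('k) = q" and card_ext: "CARD('f) = r"
begin

abbreviation Tr :: "'f \<Rightarrow> 'k" where "Tr \<equiv> field_trace emb m"

lemma card_gt_1: "q > 1" "r > 1"
proof -
  have "card {0, 1::'k} \<le> q" "card {0, 1::'f} \<le> r"
    unfolding card_base[symmetric] card_ext[symmetric] by (rule card_mono; simp)+
  thus "q > 1" "r > 1" by auto
qed

lemma inj_emb: "inj emb"
  by (simp add: inj_f)

lemma char_ext: "CHAR('f) = p"
proof -
  have pr: "prime CHAR('f)"
    by (rule prime_CHAR_semidom) (simp add: finite_imp_CHAR_pos)
  moreover have "CHAR('f) dvd p ^ (s * m)"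
    using CHAR_dvd_CARD[where 'a='f] by (simp add: card_ext q_eq r_eq power_mult)
  ultimately show ?thesis
    using prime_p prime_dvd_power primes_dvd_imp_eq by blast
qed

lemma frobenius_sum: "sum f A ^ (q ^ k) = (\<Sum>i\<in>A. f i ^ (q ^ k))" for f :: "'i \<Rightarrow> 'f"
  by (rule freshmans_dream_sum'[where n = "s * k"])
     (simp_all add: char_ext prime_p q_eq power_mult)

lemma frobenius_add: "(x + y) ^ (q ^ k) = x ^ (q ^ k) + y ^ (q ^ k)" for x y :: 'f
  by (rule freshmans_dream'[where n = "s * k"])
     (simp_all add: char_ext prime_p q_eq power_mult)

lemma emb_fixed: "emb c ^ (q ^ k) = emb c"
proof (induction k)
  case (Suc k)
  have "emb c ^ (q ^ Suc k) = (emb c ^ (q ^ k)) ^ q" by (simp add: power_mult[symmetric] mult.commute)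
  also have "\<dots> = emb (c ^ q)" by (simp add: Suc hom_power)
  finally show ?case using finite_field_power_card[of c] by (simp add: card_base)
qed simp

text \<open>Elements of the image satisfy y^q = y, and X^q - X has at most q roots, so the q
  elements of the image exhaust them. Membership in the base field becomes a single
  equation.\<close>

lemma range_emb: "range emb = {y. y ^ q = y}"
proof (rule card_seteq)
  define P :: "'f poly" where "P = Polynomial.monom 1 q - Polynomial.monom 1 1"
  have "Polynomial.coeff P q = 1" using card_gt_1 by (simp add: P_def)
  hence "P \<noteq> 0" by auto
  have "degree P \<le> q"
    unfolding P_def by (rule degree_diff_le) (use card_gt_1 in \<open>auto simp: degree_monom_eq\<close>)
  have "{y. y ^ q = y} = {y. poly P y = 0}" by (auto simp: P_def poly_monom)
  thus "card {y::'f. y ^ q = y} \<le> card (range emb)"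
    using card_poly_roots_bound[OF \<open>P \<noteq> 0\<close>] \<open>degree P \<le> q\<close> by (simp add: card_image inj_emb card_base)
qed (use emb_fixed[of _ 1] in auto)

text \<open>Raising the sum of conjugates to the power q shifts it cyclically because x^(q^m) = x.
  So the sum lies in the image of \<open>emb\<close>, and the \<open>inv_into\<close> in
  \<open>field_trace\<close> returns a genuine preimage.\<close>

lemma emb_trace: "emb (Tr x) = (\<Sum>k<m. x ^ (q ^ k))"
proof -
  let ?t = "\<lambda>k. x ^ (q ^ k)"
  have "(\<Sum>k<m. ?t k) ^ q = (\<Sum>k<m. ?t (Suc k))"
    using frobenius_sum[of ?t "{..<m}" 1] by (simp add: power_mult[symmetric] mult.commute)
  also have "\<dots> = (\<Sum>k<m. ?t k) + ?t m - ?t 0"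
    using sum.lessThan_Suc_shift[of ?t m] by (simp add: algebra_simps)
  also have "?t m = x" using finite_field_power_card[of x] by (simp add: card_ext r_eq)
  finally have "(\<Sum>k<m. ?t k) \<in> range emb" unfolding range_emb by simp
  thus ?thesis unfolding field_trace_def card_base by (simp add: f_inv_into_f)
qed

lemma trace_add: "Tr (x + y) = Tr x + Tr y"
  by (rule injD[OF inj_emb]) (simp add: emb_trace hom_add frobenius_add sum.distrib)

lemma trace_smult: "Tr (emb c * x) = c * Tr x"
  by (rule injD[OF inj_emb])
     (simp add: emb_trace hom_mult power_mult_distrib emb_fixed sum_distrib_left)

lemma trace_0 [simp]: "Tr 0 = 0"
  using trace_smult[of 0 0] by simp

text \<open>Otherwise a nonzero polynomial of degree at most q^(m - 1) would vanish at all q^m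
  elements.\<close>

lemma trace_nonzero: "\<exists>x. Tr x \<noteq> 0"
proof (rule ccontr)
  assume "\<nexists>x. Tr x \<noteq> 0"
  hence zero: "Tr x = 0" for x by blast
  define P :: "'f poly" where "P = (\<Sum>k<m. Polynomial.monom 1 (q ^ k))"
  have "Polynomial.coeff P (q ^ (m - 1)) = (\<Sum>k<m. if k = m - 1 then 1 else 0)"
    unfolding P_def coeff_sum using card_gt_1 by (intro sum.cong) auto
  hence "Polynomial.coeff P (q ^ (m - 1)) = 1" using m_pos by simp
  hence "P \<noteq> 0" by auto
  have "degree P \<le> q ^ (m - 1)"
    unfolding P_def using card_gt_1 m_pos
    by (intro degree_sum_le) (auto simp: degree_monom_eq intro!: power_increasing)
  moreover have "poly P x = emb (Tr x)" for x by (simp add: P_def poly_sum poly_monom emb_trace)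
  hence "{x. poly P x = 0} = UNIV" by (simp add: zero)
  ultimately have "r \<le> q ^ (m - 1)"
    using card_poly_roots_bound[OF \<open>P \<noteq> 0\<close>] by (simp add: card_ext)
  moreover have "q ^ (m - 1) < q ^ m" using card_gt_1 m_pos by (intro power_strict_increasing) auto
  ultimately show False by (simp add: r_eq)
qed

lemma trace_mult_surj:
  assumes "z \<noteq> 0"
  shows "\<exists>y. Tr (y * z) = c"
proof -
  obtain x where "Tr x \<noteq> 0" using trace_nonzero by blast
  have "Tr (emb (c / Tr x) * (x / z) * z) = c"
    using assms trace_smult[of "c / Tr x" x] \<open>Tr x \<noteq> 0\<close> by (simp add: mult.assoc)
  thus ?thesis by blast
qed

text \<open>The functional is onto, so its q fibres are translates of the kernel.\<close>

lemma card_trace_kernel: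
  assumes "z \<noteq> 0"
  shows "q * card {y. Tr (y * z) = 0} = r"
proof -
  have "card {y. Tr (y * z) = c} = card {y. Tr (y * z) = 0}" for c
  proof -
    obtain t where t: "Tr (t * z) = c" using trace_mult_surj[OF assms] by blast
    have "Tr ((y - t) * z) = Tr (y * z) - c" for y
      using trace_add[of "(y - t) * z" "t * z"] t by (simp add: algebra_simps)
    moreover have "Tr ((y + t) * z) = Tr (y * z) + c" for y
      by (simp add: distrib_right trace_add t)
    ultimately have "bij_betw (\<lambda>y. y - t) {y. Tr (y * z) = c} {y. Tr (y * z) = 0}"
      by (intro bij_betwI[where g = "\<lambda>y. y + t"]) auto
    thus ?thesis by (rule bij_betw_same_card)
  qed
  hence "(\<Sum>c\<in>UNIV. card {y. Tr (y * z) = c}) = q * card {y. Tr (y * z) = 0}"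
    by (subst sum.cong[OF refl, of _ _ "\<lambda>_. card {y. Tr (y * z) = 0}"]) (simp_all add: card_base)
  thus ?thesis using card_eq_sum_fibres[of "\<lambda>y. Tr (y * z)"] by (simp add: card_ext)
qed

text \<open>
  The kernels of the \<open>q + 1\<close> functionals \<open>y \<mapsto> Tr (y z')\<close> and \<open>y \<mapsto> Tr (y (z + c z'))\<close> all have
  the same size, and every \<open>y\<close> outside the joint kernel lies in exactly one of them.
\<close>
lemma card_trace_joint_kernel:
  assumes "z' \<noteq> 0" and indep: "\<And>c. z \<noteq> emb c * z'"
  shows "q ^ 2 * card {y. Tr (y * z) = 0 \<and> Tr (y * z') = 0} = r"
proof -
  define K where "K = {y. Tr (y * z) = 0 \<and> Tr (y * z') = 0}"
  define k where "k = card {y. Tr (y * z') = 0}"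
  have ne: "z + emb c * z' \<noteq> 0" for c
    using indep[of "- c"] by (auto simp: hom_uminus add_eq_0_iff2)
  have k: "q * k = r" unfolding k_def by (rule card_trace_kernel) fact
  have "card {y. Tr (y * (z + emb c * z')) = 0} = k" for c
    using card_trace_kernel[OF ne, of c] k card_gt_1 by (metis mult_cancel1 not_less0)
  \<comment> \<open>The single \<open>k\<close> belongs to the functional of z', the other q to
    those of z + c z'.\<close>
  hence "q * k + k = (\<Sum>c\<in>UNIV. card {y\<in>UNIV. Tr (y * (z + emb c * z')) = 0}) + k" by (simp add: card_base)
  also have "(\<Sum>c\<in>UNIV. card {y\<in>UNIV. Tr (y * (z + emb c * z')) = 0}) =
      (\<Sum>y\<in>UNIV. card {c\<in>UNIV. Tr (y * (z + emb c * z')) = 0})"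
    by (rule sum_card_swap) auto
  also have "\<dots> + k = (\<Sum>y\<in>UNIV. card {c. Tr (y * (z + emb c * z')) = 0} + (if Tr (y * z') = 0 then 1 else 0))"
    by (simp add: sum.distrib k_def sum.If_cases)
  also have "\<dots> = (\<Sum>y\<in>UNIV. 1 + (if y \<in> K then q else 0))"
  proof (rule sum.cong)
    fix y :: 'f
    have eq: "Tr (y * (z + emb c * z')) = Tr (y * z) + c * Tr (y * z')" for c
      using trace_smult[of c "y * z'"] by (simp add: trace_add algebra_simps)
    show "card {c. Tr (y * (z + emb c * z')) = 0} + (if Tr (y * z') = 0 then 1 else 0) =
        1 + (if y \<in> K then q else 0)"
    proof (cases "Tr (y * z') = 0")
      case True
      thus ?thesis by (simp add: eq K_def card_base)
    next
      case False
      hence "{c. Tr (y * (z + emb c * z')) = 0} = {- Tr (y * z) / Tr (y * z')}"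
        unfolding eq by (auto simp: field_simps add_eq_0_iff2)
      thus ?thesis using False by (simp add: K_def)
    qed
  qed simp
  also have "\<dots> = r + q * card K"
    by (subst sum.distrib) (simp add: sum.If_cases mult.commute card_ext)
  \<comment> \<open>Together with q * k = r the equation gives k = q * card K, so q^2 * card K = q *
    k = r.\<close>
  finally show ?thesis using k by (simp add: K_def power2_eq_square)
qed

end

section \<open>The quadratic character\<close>

definition qchar :: "'a::field \<Rightarrow> int" where
  "qchar x = (if x = 0 then 0 else if \<exists>z. x = z ^ 2 then 1 else - 1)"

lemma qchar_0 [simp]: "qchar 0 = 0"
  by (simp add: qchar_def)

lemma qchar_eq_0_iff [simp]: "qchar x = 0 \<longleftrightarrow> x = 0"
  by (simp add: qchar_def)

lemma qchar_cases: "qchar x = 0 \<or> qchar x = 1 \<or> qchar x = - 1"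
  by (simp add: qchar_def)

lemma sum_lessThan_periodic_Suc:
  fixes g :: "nat \<Rightarrow> 'a::comm_monoid_add"
  assumes "g n = g 0"
  shows "(\<Sum>i<n. g (Suc i)) = (\<Sum>i<n. g i)"
proof (cases n)
  case (Suc k)
  then show ?thesis
    using assms sum.lessThan_Suc_shift[of g k] by (simp add: add.commute)
qed simp

text \<open>For even m the number q^m is an odd square, hence 1 modulo 8. For odd m it is q modulo
  8, so 4 | q - 1, and the even index supplies the remaining factor 2. The lemma serves to show that
  fourth roots of unity are squares.\<close>

lemma eight_dvd_card:
  fixes q m :: nat
  assumes "m \<ge> 1" "q > 1" "4 dvd q ^ m - 1" "even ((q ^ m - 1) div (q - 1))" "q - 1 dvd q ^ m - 1"
  shows "8 dvd q ^ m - 1"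
proof -
  have qm: "q ^ m > 0" using assms(2) by simp
  have "odd q"
  proof
    assume "even q"
    hence "even (q ^ m)" using assms(1) by simp
    moreover have "even (q ^ m - 1)" using assms(3) by (rule dvd_trans[rotated]) simp
    ultimately show False using qm by simp
  qed
  have sq: "8 dvd x ^ 2 - 1" if "odd x" for x :: nat
  proof -
    obtain k where k: "x = 2 * k + 1" using \<open>odd x\<close> by (rule oddE)
    have "x ^ 2 - 1 = 4 * (k * (k + 1))" by (simp add: k power2_eq_square algebra_simps)
    moreover obtain l where "k * (k + 1) = 2 * l" by (metis evenE even_mult_iff even_plus_one_iff)
    ultimately have "x ^ 2 - 1 = 4 * (2 * l)" by (simp only:)
    thus ?thesis by simp
  qed
  show ?thesis
  proof (cases "even m")
    case True
    then obtain k where "m = 2 * k" by (rule evenE)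
    hence "q ^ m = (q ^ k) ^ 2" by (simp only: power_even_eq)
    thus ?thesis using sq[of "q ^ k"] \<open>odd q\<close> by simp
  next
    case False
    then obtain k where "m = 2 * k + 1" by (rule oddE)
    hence "q ^ m = q * (q ^ k) ^ 2" by (simp add: power_even_eq)
    moreover obtain j where j: "(q ^ k) ^ 2 - 1 = 8 * j" using sq[of "q ^ k"] \<open>odd q\<close> by auto
    moreover have "(q ^ k) ^ 2 \<ge> 1" using assms(2) by simp
    hence "(q ^ k) ^ 2 = 8 * j + 1" using j by linarith
    ultimately have "q ^ m = q * (8 * j + 1)" by (simp only:)
    hence eq: "q ^ m - 1 = 4 * (2 * (q * j)) + (q - 1)" using assms(2) by simp
    have "4 dvd q - 1" using assms(3) unfolding eq by (subst (asm) dvd_add_right_iff) simp_all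
    moreover have "q ^ m - 1 = (q ^ m - 1) div (q - 1) * (q - 1)" using assms(5) by simp
    ultimately have "2 * 4 dvd q ^ m - 1" using mult_dvd_mono[OF assms(4), of 4 "q - 1"] by (simp only:)
    thus ?thesis by simp
  qed
qed

text \<open>The last two assumptions are what \<open>e = 4\<close> and \<open>N = 2\<close> provide:
  e divides r - 1, and the index (r - 1)/(q - 1) is a multiple of N.\<close>

locale primitive_extension = finite_extension emb p s m q r
  for emb :: "'k::{field,finite} \<Rightarrow> 'f::{field,finite}" and p s m q r +
  fixes \<gamma> :: 'f
  assumes range_powi: "range (\<lambda>k::int. \<gamma> powi k) = UNIV - {0}"
    and four_dvd: "4 dvd r - 1"
    and even_index: "even ((r - 1) div (q - 1))"
begin

lemma gamma_nonzero [simp]: "\<gamma> \<noteq> 0"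
proof
  assume "\<gamma> = 0"
  hence "0 \<in> range (\<lambda>k::int. \<gamma> powi k)" by (intro range_eqI[of _ _ 1]) simp
  thus False by (simp add: range_powi)
qed

lemma powi_exists: "x \<noteq> 0 \<Longrightarrow> \<exists>k::int. x = \<gamma> powi k"
  using range_powi by blast

lemma card_eq_1_mod_4: obtains j where "r = 4 * j + 1" "j > 0"
proof -
  obtain j where j: "r - 1 = 4 * j" using four_dvd by blast
  moreover have "r = r - 1 + 1" "r - 1 > 0" using card_gt_1 by auto
  ultimately show thesis using that by (metis mult_is_0 not_gr0)
qed

lemma powi_order: "\<gamma> powi (int (r - 1)) = 1"
proof -
  have "\<gamma> ^ r = \<gamma>" using finite_field_power_card[of \<gamma>] by (simp add: card_ext)
  moreover have "r = Suc (r - 1)" using card_gt_1 by simp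
  ultimately have "\<gamma> * \<gamma> ^ (r - 1) = \<gamma> * 1" by (metis mult.right_neutral power_Suc)
  thus ?thesis by simp
qed

lemma powi_order_mult [simp]: "\<gamma> powi (int (r - Suc 0) * k) = 1"
  using powi_order by (simp add: power_int_mult)

lemma powi_cong:
  assumes "[i = j] (mod int (r - 1))"
  shows "\<gamma> powi i = \<gamma> powi j"
proof -
  obtain k where "i = j + int (r - 1) * k"
    using assms by (metis cong_iff_lin cong_sym)
  thus ?thesis by (simp add: power_int_add)
qed

lemma powi_eq_1_iff: "\<gamma> powi k = 1 \<longleftrightarrow> int (r - 1) dvd k"
proof
  assume "int (r - 1) dvd k"
  thus "\<gamma> powi k = 1" by (auto elim!: dvdE)
next
  assume eq: "\<gamma> powi k = 1"
  show "int (r - 1) dvd k"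
  proof (rule ccontr)
    assume nd: "\<not> int (r - 1) dvd k"
    define d where "d = k mod int (r - 1)"
    have r1: "int (r - 1) > 0" using card_gt_1 by simp
    have d: "0 < d" "d < int (r - 1)"
      using nd pos_mod_bound[OF r1, of k] pos_mod_sign[OF r1, of k]
      unfolding d_def dvd_eq_mod_eq_0 by linarith+
    have "\<gamma> powi d = 1"
      using powi_cong[of d k] eq by (simp add: d_def cong_def)
    \<comment> \<open>Exponents can be reduced modulo d, so \<gamma> has at most d < r - 1 distinct
      powers, too few for all nonzero elements.\<close>
    hence md: "\<gamma> powi j = \<gamma> powi (j mod d)" for j
      by (subst mult_div_mod_eq[of d j, symmetric], subst power_int_add)
         (simp_all add: power_int_mult)
    have "range (\<lambda>k::int. \<gamma> powi k) \<subseteq> (\<lambda>k::int. \<gamma> powi k) ` {0..<d}"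
    proof
      fix x assume "x \<in> range (\<lambda>k::int. \<gamma> powi k)"
      then obtain j where "x = \<gamma> powi j" by blast
      thus "x \<in> (\<lambda>k::int. \<gamma> powi k) ` {0..<d}"
        using d md[of j] by (intro image_eqI[of _ _ "j mod d"]) auto
    qed
    hence "card (UNIV - {0::'f}) \<le> card ((\<lambda>k::int. \<gamma> powi k) ` {0..<d})"
      unfolding range_powi by (intro card_mono) auto
    also have "\<dots> \<le> nat d" using card_image_le[of "{0..<d}" "\<lambda>k::int. \<gamma> powi k"] by simp
    finally show False using d by (simp add: card_Diff_singleton card_ext)
  qed
qed

lemma even_order: "even (int (r - 1))"
proof -
  obtain j where "r = 4 * j + 1" by (rule card_eq_1_mod_4)
  thus ?thesis by simp
qed

text \<open>The order r - 1 of \<gamma> is even, so an element determines the parity of its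
  exponent. Multiplicativity of \<open>qchar\<close> reduces to the parity of a sum.\<close>

lemma qchar_powi: "qchar (\<gamma> powi k) = (if even k then 1 else - 1)"
proof (cases "even k")
  case True
  then obtain j where "k = j * 2" by (metis evenE mult.commute)
  hence "\<gamma> powi k = (\<gamma> powi j) ^ 2" by (simp add: power_int_mult)
  thus ?thesis using True by (auto simp: qchar_def power_int_not_zero)
next
  case False
  have "\<gamma> powi k \<noteq> z ^ 2" for z
  proof
    assume *: "\<gamma> powi k = z ^ 2"
    hence "z \<noteq> 0" by (auto simp: power_int_not_zero)
    then obtain j where "z = \<gamma> powi j" using powi_exists by blast
    hence "\<gamma> powi (k - j * 2) = 1" using * by (simp add: power_int_diff power_int_mult)
    hence "even (k - j * 2)" using even_order powi_eq_1_iff dvd_trans by blast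
    thus False using False by simp
  qed
  thus ?thesis using False by (simp add: qchar_def power_int_not_zero)
qed

lemma qchar_mult: "qchar (x * y) = qchar x * qchar y" for x y :: 'f
proof (cases "x = 0 \<or> y = 0")
  case False
  then obtain i j where "x = \<gamma> powi i" "y = \<gamma> powi j" using powi_exists by metis
  thus ?thesis using qchar_powi[of "i + j"] by (auto simp: power_int_add qchar_powi)
qed auto

lemma qchar_1: "qchar (1::'f) = 1"
  using qchar_powi[of 0] by simp

lemma qchar_gamma: "qchar \<gamma> = - 1"
  using qchar_powi[of 1] by simp

lemma qchar_inverse: "qchar (inverse x) = qchar x" for x :: 'f
proof (cases "x = 0")
  case False
  hence "qchar x * qchar (inverse x) = 1" by (simp flip: qchar_mult add: qchar_1)
  thus ?thesis using qchar_cases[of x] by auto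
qed simp

lemma qchar_divide: "qchar (x / y) = qchar x * qchar y" for x y :: 'f
  by (simp add: divide_inverse qchar_mult qchar_inverse)

lemma not_dvd_half: "\<not> r - 1 dvd (r - 1) div 2"
proof -
  obtain j where "r = 4 * j + 1" "j > 0" by (rule card_eq_1_mod_4)
  thus ?thesis by (auto dest: dvd_imp_le)
qed

lemma neg_1_powi: "\<gamma> powi (int ((r - 1) div 2)) = - 1"
proof -
  let ?h = "\<gamma> powi (int ((r - 1) div 2))"
  have "int ((r - 1) div 2) * 2 = int (r - 1)"
    using even_order unfolding even_of_nat by (metis dvd_div_mult_self of_nat_mult of_nat_numeral)
  hence "?h ^ 2 = 1" using powi_order by (metis power_int_mult power_int_numeral)
  moreover have "?h \<noteq> 1"
    unfolding powi_eq_1_iff int_dvd_int_iff by (rule not_dvd_half)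
  ultimately show ?thesis by (simp add: power2_eq_1_iff)
qed

lemma neg_1_neq_1: "(- 1 :: 'f) \<noteq> 1"
  using not_dvd_half powi_eq_1_iff[of "int ((r - 1) div 2)"]
  unfolding neg_1_powi int_dvd_int_iff by simp

text \<open>-1 is \<gamma>^((r - 1)/2), and this exponent is even because 4 divides r - 1.\<close>

lemma qchar_uminus: "qchar (- x) = qchar x" for x :: 'f
proof -
  obtain j where "r = 4 * j + 1" by (rule card_eq_1_mod_4)
  hence "qchar (- 1 :: 'f) = 1"
    unfolding neg_1_powi[symmetric] qchar_powi by simp
  thus ?thesis using qchar_mult[of "- 1" x] by simp
qed

lemma bij_mult_left: "u \<noteq> 0 \<Longrightarrow> bij_betw (\<lambda>z. u * z) {z. P (u * z)} {z. P z}" for u :: 'f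
  by (rule bij_betwI[where g = "\<lambda>z. z / u"]) auto

lemma card_mult_left: "u \<noteq> 0 \<Longrightarrow> card {z. P (u * z)} = card {z. P z}" for u :: 'f
  using bij_betw_same_card[OF bij_mult_left] .

lemma card_nonzero_split:
  "card {z::'f. z \<noteq> 0 \<and> P z} = card {z. qchar z = 1 \<and> P z} + card {z. qchar z = - 1 \<and> P z}"
proof -
  have "{z::'f. z \<noteq> 0 \<and> P z} = {z. qchar z = 1 \<and> P z} \<union> {z. qchar z = - 1 \<and> P z}"
    using qchar_cases by (auto simp flip: qchar_eq_0_iff)
  thus ?thesis by (simp add: card_Un_disjoint disjoint_iff)
qed

lemma card_qchar:
  "real (card {z::'f. qchar z = 1}) = (real r - 1) / 2"
  "real (card {z::'f. qchar z = - 1}) = (real r - 1) / 2"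
proof -
  have "card {z::'f. qchar z = - 1} = card {z::'f. qchar z = 1}"
    using card_mult_left[of \<gamma> "\<lambda>z. qchar z = - 1"] by (simp add: qchar_mult qchar_gamma)
  moreover have "card {z::'f. z \<noteq> 0} = r - 1"
    using card_ext by (simp add: card_Diff_singleton Collect_neg_eq Compl_eq_Diff_UNIV)
  ultimately show "real (card {z::'f. qchar z = 1}) = (real r - 1) / 2"
     "real (card {z::'f. qchar z = - 1}) = (real r - 1) / 2"
    using card_nonzero_split[of "\<lambda>_. True"] card_gt_1 by auto
qed

lemma index_mult: "(r - 1) div (q - 1) * (q - 1) = r - 1"
proof -
  obtain c where c: "q = Suc c" using card_gt_1 by (cases q) auto
  have "\<exists>k. q ^ j = c * k + 1" for j
  proof (induction j)
    case (Suc j)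
    then obtain k where "q ^ j = c * k + 1" by blast
    hence "q ^ Suc j = c * (k * q + 1) + 1" by (simp add: c algebra_simps)
    thus ?case by blast
  qed simp
  then obtain k where "q ^ m = c * k + 1" by blast
  thus ?thesis using card_gt_1 by (simp add: r_eq c)
qed

lemma eight_dvd: "8 dvd r - 1"
  using eight_dvd_card[OF m_pos card_gt_1(1), folded r_eq] four_dvd even_index index_mult
  by (metis dvd_triv_right)

text \<open>The (q - 1)-th power of such an element is 1, so it solves y^q = y. These elements are
  the F_q part of the Bezout splitting in \<open>orbit_count_eq\<close>.\<close>

lemma powi_index_in_range: "\<gamma> powi (int ((r - 1) div (q - 1)) * k) \<in> range emb"
proof -
  let ?x = "\<gamma> powi (int ((r - 1) div (q - 1)) * k)"
  have "?x ^ (q - 1) = \<gamma> powi (int ((r - 1) div (q - 1)) * k * int (q - 1))"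
    by (simp add: power_int_mult)
  also have "int ((r - 1) div (q - 1)) * k * int (q - 1) = int (r - 1) * k"
    by (subst (2) index_mult[symmetric]) simp
  finally have "?x ^ (q - 1) = 1" by simp
  moreover have "q = Suc (q - 1)" using card_gt_1 by simp
  ultimately have "?x ^ q = ?x" by (metis mult.right_neutral power_Suc)
  thus ?thesis by (simp add: range_emb)
qed

text \<open>A nonzero element of F_q has (q - 1)-th power 1, so its exponent is a multiple of (r -
  1)/(q - 1), which is even.\<close>

lemma qchar_hom: "c \<noteq> 0 \<Longrightarrow> qchar (emb c) = 1"
proof -
  assume "c \<noteq> 0"
  hence "emb c \<noteq> 0" by simp
  then obtain k where k: "emb c = \<gamma> powi k" using powi_exists by blast
  have "emb c * emb c ^ (q - 1) = emb c"
    using emb_fixed[of c 1] card_gt_1 by (simp add: power_eq_if)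
  hence "\<gamma> powi (k * int (q - 1)) = 1"
    using \<open>emb c \<noteq> 0\<close> by (simp add: power_int_mult k)
  hence "int ((r - 1) div (q - 1)) * int (q - 1) dvd k * int (q - 1)"
    unfolding powi_eq_1_iff of_nat_mult[symmetric] index_mult .
  hence "int ((r - 1) div (q - 1)) dvd k" using card_gt_1 by (simp only: dvd_mult_cancel_right) simp
  moreover have "even (int ((r - 1) div (q - 1)))" using even_index by simp
  ultimately have "even k" using dvd_trans by blast
  thus ?thesis by (simp add: k qchar_powi)
qed

end

section \<open>Traces on squares\<close>

context primitive_extension
begin

text \<open>This count and its complement among the squares play the part of the Gauss periods of
  order two, without additive characters or complex numbers.\<close>

definition squares_zero :: "'f \<Rightarrow> nat" where
  "squares_zero y = card {z. qchar z = 1 \<and> Tr (y * z) = 0}"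

definition squares_nonzero :: "'f \<Rightarrow> nat" where
  "squares_nonzero y = card {z. qchar z = 1 \<and> Tr (y * z) \<noteq> 0}"

lemma squares_zero_mult_square:
  assumes "qchar u = 1"
  shows "squares_zero (y * u) = squares_zero y"
proof -
  have "u \<noteq> 0" using assms by auto
  thus ?thesis
    using card_mult_left[of u "\<lambda>z. qchar z = 1 \<and> Tr (y * z) = 0"] assms
    by (simp add: squares_zero_def qchar_mult mult.assoc)
qed

lemma squares_zero_cases:
  assumes "y \<noteq> 0"
  shows "squares_zero y = (if qchar y = 1 then squares_zero 1 else squares_zero \<gamma>)"
proof (cases "qchar y = 1")
  case True
  thus ?thesis using squares_zero_mult_square[of y 1] by simp
next
  case False
  hence "qchar y = - 1" using assms qchar_cases[of y] by simp
  hence "qchar (y / \<gamma>) = 1" by (simp add: qchar_divide qchar_gamma)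
  thus ?thesis using squares_zero_mult_square[of "y / \<gamma>" \<gamma>] False by simp
qed

lemma card_nonzero_kernel:
  assumes "z \<noteq> 0"
  shows "real (card {y. y \<noteq> 0 \<and> Tr (y * z) = 0}) = real r / real q - 1"
proof -
  have "{y. Tr (y * z) = 0} = insert 0 {y. y \<noteq> 0 \<and> Tr (y * z) = 0}" by auto
  hence "card {y. Tr (y * z) = 0} = card {y. y \<noteq> 0 \<and> Tr (y * z) = 0} + 1" by simp
  hence "q * (card {y. y \<noteq> 0 \<and> Tr (y * z) = 0} + 1) = r" using card_trace_kernel[OF assms] by simp
  hence "real q * (real (card {y. y \<noteq> 0 \<and> Tr (y * z) = 0}) + 1) = real r"
    by (metis of_nat_1 of_nat_add of_nat_mult)
  thus ?thesis using card_gt_1 by (simp add: field_simps)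
qed

lemma card_nonzero_joint_kernel:
  assumes "z' \<noteq> 0" and "\<And>c. z \<noteq> emb c * z'"
  shows "real (card {y. y \<noteq> 0 \<and> Tr (y * z) = 0 \<and> Tr (y * z') = 0}) = real r / real q ^ 2 - 1"
proof -
  let ?K = "{y. y \<noteq> 0 \<and> Tr (y * z) = 0 \<and> Tr (y * z') = 0}"
  have "{y. Tr (y * z) = 0 \<and> Tr (y * z') = 0} = insert 0 ?K" by auto
  hence "card {y. Tr (y * z) = 0 \<and> Tr (y * z') = 0} = card ?K + 1" by simp
  hence "q ^ 2 * (card ?K + 1) = r" using card_trace_joint_kernel[OF assms] by simp
  hence "real (q ^ 2 * (card ?K + 1)) = real r" by (rule arg_cong)
  hence "real q ^ 2 * (real (card ?K) + 1) = real r" by (simp add: distrib_left)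
  thus ?thesis using card_gt_1 by (simp add: field_simps)
qed

text \<open>Multiplication by \<gamma> turns squares into nonsquares, so the second count is the
  number of nonsquares of trace zero; together the counts cover all nonzero elements of trace
  zero.\<close>

lemma squares_zero_sum: "real (squares_zero 1) + real (squares_zero \<gamma>) = real r / real q - 1"
proof -
  have "squares_zero \<gamma> = card {z. qchar z = - 1 \<and> Tr z = 0}"
    using card_mult_left[of \<gamma> "\<lambda>z. qchar z = - 1 \<and> Tr z = 0"]
    by (simp add: squares_zero_def qchar_mult qchar_gamma)
  hence "squares_zero 1 + squares_zero \<gamma> = card {z. z \<noteq> 0 \<and> Tr z = 0}"
    by (simp add: squares_zero_def card_nonzero_split)
  thus ?thesis using card_nonzero_kernel[of 1] by simp
qed

text \<open>Double counting of triples (y, z, z') with y nonzero, z and z' squares, and Tr (y z) =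
  Tr (y z') = 0. For fixed z' the q - 1 squares z on the line of z' admit r/q - 1 values y each, and
  all other squares z admit r/q^2 - 1.\<close>

lemma squares_zero_sum_squares:
  "real (squares_zero 1) ^ 2 + real (squares_zero \<gamma>) ^ 2 =
     (real r - 1) / 2 * (real r / real q ^ 2 - 1) + (real q - 1) * (real r / real q - real r / real q ^ 2)"
    (is "_ = ?R")
proof -
  define S where "S = {z::'f. qchar z = 1}"
  define U where "U = UNIV - {0::'f}"
  have cS: "real (card S) = (real r - 1) / 2" unfolding S_def by (rule card_qchar)
  have inner: "(\<Sum>z\<in>S. real (card {y\<in>U. Tr (y * z) = 0 \<and> Tr (y * z') = 0})) = ?R" if "z' \<in> S" for z'
  proof -
    from that have "z' \<noteq> 0" by (auto simp: S_def)
    \<comment> \<open>The F_q-line of z' without 0. By \<open>qchar_hom\<close> it lies inside the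
      squares.\<close>
    define D where "D = (\<lambda>c. emb c * z') ` (UNIV - {0})"
    have "D \<subseteq> S" using that by (auto simp: D_def S_def qchar_mult qchar_hom)
    have "card D = card (UNIV - {0::'k})"
      unfolding D_def using \<open>z' \<noteq> 0\<close> by (intro card_image inj_onI) auto
    hence cD: "real (card D) = real q - 1" using card_gt_1 by (simp add: card_Diff_singleton card_base of_nat_diff)
    have "real (card {y\<in>U. Tr (y * z) = 0 \<and> Tr (y * z') = 0}) =
        (real r / real q ^ 2 - 1) + (if z \<in> D then real r / real q - real r / real q ^ 2 else 0)"
      if "z \<in> S" for z
    proof (cases "z \<in> D")
      case True
      then obtain c where c: "c \<noteq> 0" "z = emb c * z'" by (auto simp: D_def)
      hence "Tr (y * z) = c * Tr (y * z')" for y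
        using trace_smult[of c "y * z'"] by (simp add: mult.left_commute)
      hence "{y\<in>U. Tr (y * z) = 0 \<and> Tr (y * z') = 0} = {y. y \<noteq> 0 \<and> Tr (y * z') = 0}"
        using c by (auto simp: U_def)
      thus ?thesis using True card_nonzero_kernel[OF \<open>z' \<noteq> 0\<close>] by simp
    next
      case False
      \<comment> \<open>For c = 0 the reason is z \<noteq> 0; only nonzero c are covered by z
        \<notin> D.\<close>
      have "z \<noteq> emb c * z'" for c
        using False \<open>z \<in> S\<close> by (cases "c = 0") (auto simp: D_def S_def)
      thus ?thesis using card_nonzero_joint_kernel[OF \<open>z' \<noteq> 0\<close>, of z] False by (simp add: U_def)
    qed
    hence "(\<Sum>z\<in>S. real (card {y\<in>U. Tr (y * z) = 0 \<and> Tr (y * z') = 0})) =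
        (\<Sum>z\<in>S. (real r / real q ^ 2 - 1) + (if z \<in> D then real r / real q - real r / real q ^ 2 else 0))"
      by (rule sum.cong[OF refl])
    also have "\<dots> = real (card S) * (real r / real q ^ 2 - 1) +
        real (card D) * (real r / real q - real r / real q ^ 2)"
      using \<open>D \<subseteq> S\<close> by (subst sum.distrib) (simp add: sum.If_cases Int_absorb1)
    finally show ?thesis by (simp add: cS cD)
  qed
  have "(\<Sum>y\<in>U. card {x\<in>S \<times> S. Tr (y * fst x) = 0 \<and> Tr (y * snd x) = 0}) =
      (\<Sum>x\<in>S \<times> S. card {y\<in>U. Tr (y * fst x) = 0 \<and> Tr (y * snd x) = 0})"
    by (rule sum_card_swap) auto
  moreover have "{x\<in>S \<times> S. Tr (y * fst x) = 0 \<and> Tr (y * snd x) = 0} =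
      {z. qchar z = 1 \<and> Tr (y * z) = 0} \<times> {z. qchar z = 1 \<and> Tr (y * z) = 0}" for y
    by (auto simp: S_def)
  hence "card {x\<in>S \<times> S. Tr (y * fst x) = 0 \<and> Tr (y * snd x) = 0} = squares_zero y ^ 2" for y
    by (simp add: squares_zero_def card_cartesian_product power2_eq_square)
  ultimately have "(\<Sum>y\<in>U. squares_zero y ^ 2) =
      (\<Sum>x\<in>S \<times> S. card {y\<in>U. Tr (y * fst x) = 0 \<and> Tr (y * snd x) = 0})" by simp
  hence "(\<Sum>y\<in>U. real (squares_zero y) ^ 2) =
      (\<Sum>x\<in>S \<times> S. real (card {y\<in>U. Tr (y * fst x) = 0 \<and> Tr (y * snd x) = 0}))"
    by (metis (mono_tags, lifting) of_nat_power of_nat_sum sum.cong)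
  also have "\<dots> = (\<Sum>z\<in>S. \<Sum>z'\<in>S. real (card {y\<in>U. Tr (y * z) = 0 \<and> Tr (y * z') = 0}))"
    by (simp add: sum.cartesian_product case_prod_beta)
  also have "\<dots> = (\<Sum>z'\<in>S. \<Sum>z\<in>S. real (card {y\<in>U. Tr (y * z) = 0 \<and> Tr (y * z') = 0}))"
    by (rule sum.swap)
  also have "\<dots> = (real r - 1) / 2 * ?R" by (simp add: inner cS)
  also have "(\<Sum>y\<in>U. real (squares_zero y) ^ 2) =
      (\<Sum>y\<in>S. real (squares_zero y) ^ 2) + (\<Sum>y\<in>{y. qchar y = - 1}. real (squares_zero y) ^ 2)"
  proof -
    have "U = S \<union> {y. qchar y = - 1}"
      using qchar_cases by (fastforce simp: U_def S_def)
    thus ?thesis by (simp add: sum.union_disjoint S_def disjoint_iff)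
  qed
  also have "(\<Sum>y\<in>S. real (squares_zero y) ^ 2) = (\<Sum>y\<in>S. real (squares_zero 1) ^ 2)"
  proof (rule sum.cong)
    fix y assume "y \<in> S"
    hence "y \<noteq> 0" "qchar y = 1" by (auto simp: S_def)
    thus "real (squares_zero y) ^ 2 = real (squares_zero 1) ^ 2" using squares_zero_cases[of y] by simp
  qed simp
  also have "(\<Sum>y\<in>{y. qchar y = - 1}. real (squares_zero y) ^ 2) =
      (\<Sum>y\<in>{y::'f. qchar y = - 1}. real (squares_zero \<gamma>) ^ 2)"
  proof (rule sum.cong)
    fix y :: 'f assume "y \<in> {y. qchar y = - 1}"
    hence "y \<noteq> 0" "qchar y \<noteq> 1" by auto
    thus "real (squares_zero y) ^ 2 = real (squares_zero \<gamma>) ^ 2" using squares_zero_cases[of y] by simp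
  qed simp
  \<comment> \<open>Each class of y has (r - 1)/2 elements, as many as there are choices of z', so
    this factor cancels.\<close>
  finally have "(real r - 1) / 2 * (real (squares_zero 1) ^ 2 + real (squares_zero \<gamma>) ^ 2) =
      (real r - 1) / 2 * ?R"
    by (simp add: cS card_qchar distrib_left)
  thus ?thesis using card_gt_1 by (simp only: mult_cancel_left) simp
qed

text \<open>
  The first two moments determine the pair \<open>(squares_zero 1, squares_zero \<gamma>)\<close> up to order; the sign
  \<open>\<kappa>\<close> of the quadratic Gauss sum stays undetermined.
\<close>
lemma squares_nonzero_eq:
  "\<exists>\<kappa>::real. (\<kappa> = 1 \<or> \<kappa> = - 1) \<and> (\<forall>y. y \<noteq> 0 \<longrightarrow>
      real (squares_nonzero y) = (real q - 1) / (2 * real q) * (real r + \<kappa> * real_of_int (qchar y) * sqrt r))"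
proof -
  define Zp Zm where "Zp = real (squares_zero 1)" and "Zm = real (squares_zero \<gamma>)"
  have q0: "real q > 0" using card_gt_1 by simp
  have s: "Zp + Zm = real r / real q - 1"
    using squares_zero_sum by (simp add: Zp_def Zm_def)
  \<comment> \<open>The sum and the sum of squares of two numbers determine the square of their
    difference.\<close>
  have "(Zp - Zm) ^ 2 = 2 * (Zp ^ 2 + Zm ^ 2) - (Zp + Zm) ^ 2"
    by (simp add: power2_eq_square algebra_simps)
  also have "\<dots> = 2 * ((real r - 1) / 2 * (real r / real q ^ 2 - 1) +
      (real q - 1) * (real r / real q - real r / real q ^ 2)) - (real r / real q - 1) ^ 2"
    unfolding s unfolding Zp_def Zm_def squares_zero_sum_squares ..
  also have "\<dots> = real r * ((real q - 1) / real q) ^ 2"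
    using q0 by (simp add: field_simps power2_eq_square)
  also have "\<dots> = (sqrt r * ((real q - 1) / real q)) ^ 2"
    by (simp add: power_mult_distrib power_divide)
  finally have "Zp - Zm = sqrt r * ((real q - 1) / real q) \<or> Zp - Zm = - (sqrt r * ((real q - 1) / real q))"
    by (simp only: power2_eq_iff)
  \<comment> \<open>The sign is attached with a minus because zero and nonzero traces are
    complementary among the squares; in the formula for \<open>squares_nonzero\<close> it then
    appears with a plus.\<close>
  then obtain \<kappa> :: real where \<kappa>: "\<kappa> = 1 \<or> \<kappa> = - 1"
    and d: "Zp - Zm = - \<kappa> * (sqrt r * ((real q - 1) / real q))"
    by (metis add.inverse_inverse mult_1 mult_minus_left)
  have "real (squares_nonzero y) = (real q - 1) / (2 * real q) * (real r + \<kappa> * real_of_int (qchar y) * sqrt r)"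
    if "y \<noteq> 0" for y
  proof -
    have "{z. qchar z = 1} = {z. qchar z = 1 \<and> Tr (y * z) = 0} \<union> {z. qchar z = 1 \<and> Tr (y * z) \<noteq> 0}"
      by auto
    hence "card {z::'f. qchar z = 1} = squares_zero y + squares_nonzero y"
      by (simp add: squares_zero_def squares_nonzero_def card_Un_disjoint disjoint_iff)
    hence W: "real (squares_nonzero y) = (real r - 1) / 2 - real (squares_zero y)"
      using card_qchar(1) by linarith
    have Zp: "Zp = (real r / real q - 1 - \<kappa> * (sqrt r * ((real q - 1) / real q))) / 2"
      and Zm: "Zm = (real r / real q - 1 + \<kappa> * (sqrt r * ((real q - 1) / real q))) / 2"
      using s d by auto
    show ?thesis
    proof (cases "qchar y = 1")
      case True
      hence z: "real (squares_zero y) = Zp" using squares_zero_cases[OF that] by (simp add: Zp_def)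
      show ?thesis unfolding W z Zp using q0 True by (simp add: field_simps)
    next
      case False
      hence "qchar y = - 1" using that qchar_cases[of y] by simp
      moreover from False have z: "real (squares_zero y) = Zm"
        using squares_zero_cases[OF that] by (simp add: Zm_def)
      ultimately show ?thesis unfolding W z Zm using q0 by (simp add: field_simps)
    qed
  qed
  with \<kappa> show ?thesis by blast
qed

text \<open>The range r - 1 is a period of \<gamma>^(A i) for every A, so elements of the orbit are
  counted with multiplicity and the exact order of \<gamma>^A never enters.\<close>

definition orbit_count :: "int \<Rightarrow> 'f \<Rightarrow> nat" where
  "orbit_count A y = (\<Sum>i<r - 1. of_bool (Tr (y * \<gamma> powi (A * int i)) \<noteq> 0))"

lemma orbit_count_mult_powi_Suc:
  "orbit_count A (y * \<gamma> powi A) = orbit_count A y"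
proof -
  let ?g = "\<lambda>i. of_bool (Tr (y * \<gamma> powi (A * int i)) \<noteq> 0) :: nat"
  have "y * \<gamma> powi A * \<gamma> powi (A * int i) = y * \<gamma> powi (A * int (Suc i))" for i
    by (simp add: power_int_add distrib_left)
  hence "orbit_count A (y * \<gamma> powi A) = (\<Sum>i<r - 1. ?g (Suc i))"
    by (simp only: orbit_count_def)
  also have "\<dots> = orbit_count A y"
    unfolding orbit_count_def
    by (rule sum_lessThan_periodic_Suc) (simp add: mult.commute[of A])
  finally show ?thesis .
qed

lemma orbit_count_mult_powi: "orbit_count A (y * \<gamma> powi (A * k)) = orbit_count A y"
proof (induction k arbitrary: y rule: int_induct[where k = 0])
  case (step1 i)
  have "y * \<gamma> powi (A * (i + 1)) = y * \<gamma> powi (A * i) * \<gamma> powi A"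
    by (simp add: power_int_add distrib_left)
  thus ?case using step1 orbit_count_mult_powi_Suc by metis
next
  case (step2 i)
  have "y * \<gamma> powi (A * (i - 1)) * \<gamma> powi A = y * \<gamma> powi (A * i)"
    by (simp add: right_diff_distrib power_int_diff)
  thus ?case using step2 orbit_count_mult_powi_Suc by metis
qed simp

lemma orbit_count_mult_emb:
  assumes "c \<noteq> 0"
  shows "orbit_count A (y * emb c) = orbit_count A y"
proof -
  have "Tr (y * emb c * \<gamma> powi (A * int i)) = c * Tr (y * \<gamma> powi (A * int i))" for i
    using trace_smult[of c "y * \<gamma> powi (A * int i)"] by (simp add: ac_simps)
  thus ?thesis using assms by (simp add: orbit_count_def)
qed

text \<open>Invariance under squares permits averaging over all squares u. For fixed i the factor
  \<gamma>^(A i) is itself a square, so each of the r - 1 indices contributes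
  \<open>squares_nonzero y\<close>; the 2 is r - 1 divided by the number of squares.\<close>

lemma orbit_count_eq:
  assumes gcd: "gcd (int ((r - 1) div (q - 1))) A = 2"
  shows "orbit_count A y = 2 * squares_nonzero y"
proof -
  have inv: "orbit_count A (y * u) = orbit_count A y" if u: "qchar u = 1" for y u
  proof -
    from u have "u \<noteq> 0" by auto
    then obtain k where k: "u = \<gamma> powi k" using powi_exists by blast
    have "even k" using u unfolding k qchar_powi by (simp split: if_splits)
    then obtain l where l: "k = 2 * l" by blast
    obtain v w where vw: "v * int ((r - 1) div (q - 1)) + w * A = 2"
      using bezout_int[of "int ((r - 1) div (q - 1))" A] gcd by auto
    \<comment> \<open>The even exponent k = 2 l splits into a part giving an element of F_q and a
      multiple of A; multiplication by either part preserves the count.\<close>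
    have "k = int ((r - 1) div (q - 1)) * (v * l) + A * (w * l)"
      using vw l by (metis (no_types, opaque_lifting) distrib_right mult.assoc mult.commute)
    hence u': "u = \<gamma> powi (int ((r - 1) div (q - 1)) * (v * l)) * \<gamma> powi (A * (w * l))"
      by (simp add: k power_int_add)
    obtain c where c: "\<gamma> powi (int ((r - 1) div (q - 1)) * (v * l)) = emb c"
      using powi_index_in_range by blast
    hence "c \<noteq> 0" using \<open>u \<noteq> 0\<close> u' by auto
    thus ?thesis
      unfolding u' c using orbit_count_mult_emb orbit_count_mult_powi by (metis mult.assoc)
  qed
  have evA: "even A" using gcd by (metis gcd_dvd2)
  define S where "S = {z::'f. qchar z = 1}"
  have "card S * orbit_count A y = (\<Sum>u\<in>S. orbit_count A (y * u))"
    by (simp add: S_def inv)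
  also have "\<dots> = (\<Sum>i<r - 1. \<Sum>u\<in>S. of_bool (Tr (y * u * \<gamma> powi (A * int i)) \<noteq> 0))"
    unfolding orbit_count_def by (rule sum.swap)
  also have "\<dots> = (\<Sum>i<r - 1. squares_nonzero y)"
  proof (rule sum.cong)
    fix i
    let ?g = "\<gamma> powi (A * int i)"
    have g: "qchar ?g = 1" using evA by (simp add: qchar_powi)
    have "(\<Sum>u\<in>S. of_bool (Tr (y * u * ?g) \<noteq> 0)) = card {u. qchar (?g * u) = 1 \<and> Tr (y * (?g * u)) \<noteq> 0}"
      using g by (simp add: S_def of_bool_def sum.If_cases Int_def qchar_mult ac_simps)
    also have "\<dots> = squares_nonzero y"
      unfolding squares_nonzero_def
      using card_mult_left[of ?g "\<lambda>u. qchar u = 1 \<and> Tr (y * u) \<noteq> 0"]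
      by (simp add: power_int_not_zero)
    finally show "(\<Sum>u\<in>S. of_bool (Tr (y * u * ?g) \<noteq> 0)) = squares_nonzero y" .
  qed simp
  also have "\<dots> = (r - 1) * squares_nonzero y" by simp
  also have "real r = real (card S * 2 + 1)" using card_qchar(1) by (simp add: S_def)
  hence "r - 1 = card S * 2" unfolding of_nat_eq_iff by simp
  finally have "card S * orbit_count A y = card S * (2 * squares_nonzero y)" by (simp only: mult.assoc)
  moreover have "card S \<noteq> 0" using \<open>r - 1 = card S * 2\<close> card_gt_1 by linarith
  ultimately show ?thesis by simp
qed

text \<open>One sign serves all y and all A. The case y = 0 fits in because both terms vanish
  there.\<close>

lemma orbit_count_formula:
  "\<exists>\<kappa>::real. (\<kappa> = 1 \<or> \<kappa> = - 1) \<and> (\<forall>y A. gcd (int ((r - 1) div (q - 1))) A = 2 \<longrightarrow>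
      real (orbit_count A y) =
        (real q - 1) / real q * (of_bool (y \<noteq> 0) * real r + \<kappa> * real_of_int (qchar y) * sqrt r))"
proof -
  obtain \<kappa> :: real where \<kappa>: "\<kappa> = 1 \<or> \<kappa> = - 1" and
    W: "\<And>y. y \<noteq> 0 \<Longrightarrow>
      real (squares_nonzero y) = (real q - 1) / (2 * real q) * (real r + \<kappa> * real_of_int (qchar y) * sqrt r)"
    using squares_nonzero_eq by blast
  have "real (orbit_count A y) =
        (real q - 1) / real q * (of_bool (y \<noteq> 0) * real r + \<kappa> * real_of_int (qchar y) * sqrt r)"
    if "gcd (int ((r - 1) div (q - 1))) A = 2" for y A
  proof (cases "y = 0")
    case True
    thus ?thesis by (simp add: orbit_count_def)
  next
    case False
    thus ?thesis using W[OF False] by (simp add: orbit_count_eq[OF that])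
  qed
  with \<kappa> show ?thesis by blast
qed

end

section \<open>Quadruples with sum zero\<close>

text \<open>
  \<open>pair_num R k \<alpha> \<beta>\<close> counts the pairs of elements of quadratic classes \<open>\<alpha>\<close>, \<open>\<beta>\<close> in a field with \<open>R \<equiv> 1\<close> (mod 4)
  elements whose sum is a given element of class \<open>k\<close>; for nonzero classes these are the cyclotomic
  numbers of order two. \<open>quad_sum R G\<close> sums \<open>G\<close> over the classes of all quadruples with sum zero,
  split by the class \<open>k\<close> of the sum of the first two entries.
\<close>
definition pair_num :: "real \<Rightarrow> int \<Rightarrow> int \<Rightarrow> int \<Rightarrow> real" where
  "pair_num R k \<alpha> \<beta> =
    (if k = 0 then (if \<alpha> = \<beta> then (if \<alpha> = 0 then 1 else (R - 1) / 2) else 0)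
     else if \<alpha> = 0 then (if \<beta> = k then 1 else 0)
     else if \<beta> = 0 then (if \<alpha> = k then 1 else 0)
     else if \<alpha> = k \<and> \<beta> = k then (R - 5) / 4 else (R - 1) / 4)"

definition class_num :: "real \<Rightarrow> int \<Rightarrow> real" where
  "class_num R k = (if k = 0 then 1 else (R - 1) / 2)"

definition pair_sum :: "real \<Rightarrow> int \<Rightarrow> (int \<Rightarrow> int \<Rightarrow> real) \<Rightarrow> real" where
  "pair_sum R k H = (\<Sum>\<alpha>\<in>{- 1, 0, 1}. \<Sum>\<beta>\<in>{- 1, 0, 1}. pair_num R k \<alpha> \<beta> * H \<alpha> \<beta>)"

definition quad_sum :: "real \<Rightarrow> (int \<Rightarrow> int \<Rightarrow> int \<Rightarrow> int \<Rightarrow> real) \<Rightarrow> real" where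
  "quad_sum R G = (\<Sum>k\<in>{- 1, 0, 1}. class_num R k * pair_sum R k (\<lambda>\<alpha> \<beta>. pair_sum R k (G \<alpha> \<beta>)))"

text \<open>With R = 4 A + 1 the cyclotomic numbers are A - 1 and A. The summand sees a pair only
  through its number of nonzero entries and the sum of its classes, the two data that determine a
  weight.\<close>

lemma pair_sum_even:
  fixes h :: "int \<Rightarrow> int \<Rightarrow> real"
  shows "pair_sum (4 * A + 1) 0 (\<lambda>\<alpha> \<beta>. h (\<bar>\<alpha>\<bar> + \<bar>\<beta>\<bar>) (\<alpha> + \<beta>)) =
       h 0 0 + 2 * A * h 2 2 + 2 * A * h 2 (- 2)"
    "pair_sum (4 * A + 1) 1 (\<lambda>\<alpha> \<beta>. h (\<bar>\<alpha>\<bar> + \<bar>\<beta>\<bar>) (\<alpha> + \<beta>)) =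
       2 * h 1 1 + (A - 1) * h 2 2 + 2 * A * h 2 0 + A * h 2 (- 2)"
    "pair_sum (4 * A + 1) (- 1) (\<lambda>\<alpha> \<beta>. h (\<bar>\<alpha>\<bar> + \<bar>\<beta>\<bar>) (\<alpha> + \<beta>)) =
       2 * h 1 (- 1) + (A - 1) * h 2 (- 2) + 2 * A * h 2 0 + A * h 2 2"
  by (simp_all add: pair_sum_def pair_num_def algebra_simps diff_divide_distrib)

text \<open>The two nonzero k give the same value: multiplying by a nonsquare and exchanging the
  entries maps (\<alpha>, \<beta>, k) to (-\<beta>, -\<alpha>, -k) and keeps \<alpha> -
  \<beta>.\<close>

lemma pair_sum_odd:
  fixes h :: "int \<Rightarrow> int \<Rightarrow> real"
  shows "pair_sum (4 * A + 1) 0 (\<lambda>\<alpha> \<beta>. h (\<bar>\<alpha>\<bar> + \<bar>\<beta>\<bar>) (\<alpha> - \<beta>)) = h 0 0 + 4 * A * h 2 0"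
    "k = 1 \<or> k = - 1 \<Longrightarrow> pair_sum (4 * A + 1) k (\<lambda>\<alpha> \<beta>. h (\<bar>\<alpha>\<bar> + \<bar>\<beta>\<bar>) (\<alpha> - \<beta>)) =
       h 1 1 + h 1 (- 1) + (2 * A - 1) * h 2 0 + A * h 2 2 + A * h 2 (- 2)"
  by (auto simp add: pair_sum_def pair_num_def algebra_simps diff_divide_distrib)

text \<open>Since \<open>f\<close> is arbitrary, one identity contains the whole distribution: an
  indicator for \<open>f\<close> gives the frequency of a single weight. The coefficients are
  symmetric under negation of the second argument, which makes an unknown sign harmless.\<close>

lemma quad_sum_even:
  "quad_sum R (\<lambda>\<alpha> \<beta> \<alpha>' \<beta>'. f ((\<bar>\<alpha>\<bar> + \<bar>\<beta>\<bar>) + (\<bar>\<alpha>'\<bar> + \<bar>\<beta>'\<bar>)) ((\<alpha> + \<beta>) + (\<alpha>' + \<beta>'))) =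
     f 0 0 + 3 * (R - 1) * (f 2 2 + f 2 (- 2)) + (R - 1) * (R - 5) / 2 * (f 3 3 + f 3 (- 3)) +
     3 * (R - 1)\<^sup>2 / 2 * (f 3 1 + f 3 (- 1)) + (R - 1) * (R\<^sup>2 - 2 * R + 9) / 16 * (f 4 4 + f 4 (- 4)) +
     (R - 1) * (R\<^sup>2 - 4 * R + 3) / 4 * (f 4 2 + f 4 (- 2)) + 3 * (R - 1) ^ 3 / 8 * f 4 0"
proof -
  define A where "A = (R - 1) / 4"
  have R: "R = 4 * A + 1" by (simp add: A_def field_simps)
  have co: "(R - 1) * (R - 5) / 2 = 8 * A ^ 2 - 8 * A" "3 * (R - 1)\<^sup>2 / 2 = 24 * A ^ 2"
    "(R - 1) * (R\<^sup>2 - 2 * R + 9) / 16 = 4 * A ^ 3 + 2 * A" "(R - 1) * (R\<^sup>2 - 4 * R + 3) / 4 = 16 * A ^ 3 - 8 * A ^ 2"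
    "3 * (R - 1) ^ 3 / 8 = 24 * A ^ 3"
    by (simp_all add: R field_simps power2_eq_square power3_eq_cube)
  \<comment> \<open>Here z and s are the contributions of the outer pair, held fixed while the inner
    pair varies.\<close>
  have k0_in: "pair_sum (4 * A + 1) 0 (\<lambda>\<alpha>' \<beta>'. f (z + (\<bar>\<alpha>'\<bar> + \<bar>\<beta>'\<bar>)) (s + (\<alpha>' + \<beta>'))) =
      f z s + 2 * A * f (z + 2) (s + 2) + 2 * A * f (z + 2) (s - 2)" for z s
    using pair_sum_even(1)[of A "\<lambda>u v. f (z + u) (s + v)"] by (simp add: algebra_simps)
  have k0: "pair_sum (4 * A + 1) 0 (\<lambda>\<alpha> \<beta>. pair_sum (4 * A + 1) 0 (\<lambda>\<alpha>' \<beta>'. f ((\<bar>\<alpha>\<bar> + \<bar>\<beta>\<bar>) + (\<bar>\<alpha>'\<bar> + \<bar>\<beta>'\<bar>)) ((\<alpha> + \<beta>) + (\<alpha>' + \<beta>')))) =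
       (f 0 0 + 2 * A * f 2 2 + 2 * A * f 2 (- 2)) +
       2 * A * (f 2 2 + 2 * A * f 4 4 + 2 * A * f 4 0) +
       2 * A * (f 2 (- 2) + 2 * A * f 4 0 + 2 * A * f 4 (- 4))"
    unfolding k0_in using pair_sum_even(1)[of A "\<lambda>z s. f z s + 2 * A * f (z + 2) (s + 2) + 2 * A * f (z + 2) (s - 2)"] by simp
  have k1_in: "pair_sum (4 * A + 1) 1 (\<lambda>\<alpha>' \<beta>'. f (z + (\<bar>\<alpha>'\<bar> + \<bar>\<beta>'\<bar>)) (s + (\<alpha>' + \<beta>'))) =
      2 * f (z + 1) (s + 1) + (A - 1) * f (z + 2) (s + 2) + 2 * A * f (z + 2) s + A * f (z + 2) (s - 2)" for z s
    using pair_sum_even(2)[of A "\<lambda>u v. f (z + u) (s + v)"] by (simp add: algebra_simps)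
  have k1: "pair_sum (4 * A + 1) 1 (\<lambda>\<alpha> \<beta>. pair_sum (4 * A + 1) 1 (\<lambda>\<alpha>' \<beta>'. f ((\<bar>\<alpha>\<bar> + \<bar>\<beta>\<bar>) + (\<bar>\<alpha>'\<bar> + \<bar>\<beta>'\<bar>)) ((\<alpha> + \<beta>) + (\<alpha>' + \<beta>')))) =
       2 * (2 * f 2 2 + (A - 1) * f 3 3 + 2 * A * f 3 1 + A * f 3 (- 1)) +
       (A - 1) * (2 * f 3 3 + (A - 1) * f 4 4 + 2 * A * f 4 2 + A * f 4 0) +
       2 * A * (2 * f 3 1 + (A - 1) * f 4 2 + 2 * A * f 4 0 + A * f 4 (- 2)) +
       A * (2 * f 3 (- 1) + (A - 1) * f 4 0 + 2 * A * f 4 (- 2) + A * f 4 (- 4))"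
    unfolding k1_in using pair_sum_even(2)[of A "\<lambda>z s. 2 * f (z + 1) (s + 1) + (A - 1) * f (z + 2) (s + 2) + 2 * A * f (z + 2) s + A * f (z + 2) (s - 2)"] by simp
  have km_in: "pair_sum (4 * A + 1) (- 1) (\<lambda>\<alpha>' \<beta>'. f (z + (\<bar>\<alpha>'\<bar> + \<bar>\<beta>'\<bar>)) (s + (\<alpha>' + \<beta>'))) =
      2 * f (z + 1) (s - 1) + (A - 1) * f (z + 2) (s - 2) + 2 * A * f (z + 2) s + A * f (z + 2) (s + 2)" for z s
    using pair_sum_even(3)[of A "\<lambda>u v. f (z + u) (s + v)"] by (simp add: algebra_simps)
  have km: "pair_sum (4 * A + 1) (- 1) (\<lambda>\<alpha> \<beta>. pair_sum (4 * A + 1) (- 1) (\<lambda>\<alpha>' \<beta>'. f ((\<bar>\<alpha>\<bar> + \<bar>\<beta>\<bar>) + (\<bar>\<alpha>'\<bar> + \<bar>\<beta>'\<bar>)) ((\<alpha> + \<beta>) + (\<alpha>' + \<beta>')))) =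
       2 * (2 * f 2 (- 2) + (A - 1) * f 3 (- 3) + 2 * A * f 3 (- 1) + A * f 3 1) +
       (A - 1) * (2 * f 3 (- 3) + (A - 1) * f 4 (- 4) + 2 * A * f 4 (- 2) + A * f 4 0) +
       2 * A * (2 * f 3 (- 1) + (A - 1) * f 4 (- 2) + 2 * A * f 4 0 + A * f 4 2) +
       A * (2 * f 3 1 + (A - 1) * f 4 0 + 2 * A * f 4 2 + A * f 4 4)"
    unfolding km_in using pair_sum_even(3)[of A "\<lambda>z s. 2 * f (z + 1) (s - 1) + (A - 1) * f (z + 2) (s - 2) + 2 * A * f (z + 2) s + A * f (z + 2) (s + 2)"] by simp
  have "quad_sum R (\<lambda>\<alpha> \<beta> \<alpha>' \<beta>'. f ((\<bar>\<alpha>\<bar> + \<bar>\<beta>\<bar>) + (\<bar>\<alpha>'\<bar> + \<bar>\<beta>'\<bar>)) ((\<alpha> + \<beta>) + (\<alpha>' + \<beta>'))) =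
     f 0 0 + 12 * A * (f 2 2 + f 2 (- 2)) + (8 * A ^ 2 - 8 * A) * (f 3 3 + f 3 (- 3)) +
     24 * A ^ 2 * (f 3 1 + f 3 (- 1)) + (4 * A ^ 3 + 2 * A) * (f 4 4 + f 4 (- 4)) +
     (16 * A ^ 3 - 8 * A ^ 2) * (f 4 2 + f 4 (- 2)) + 24 * A ^ 3 * f 4 0"
    unfolding quad_sum_def R
    by (simp add: class_num_def k0 k1 km) (simp add: algebra_simps power2_eq_square power3_eq_cube)
  moreover have "3 * (R - 1) = 12 * A" by (simp add: R)
  ultimately show ?thesis unfolding co by simp
qed

text \<open>Signs alternate along the quadruple, as they do for odd a. By
  \<open>pair_sum_odd\<close> the contributions \<open>k1\<close> and \<open>km\<close>
  coincide.\<close>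

lemma quad_sum_odd:
  "quad_sum R (\<lambda>\<alpha> \<beta> \<alpha>' \<beta>'. f ((\<bar>\<alpha>\<bar> + \<bar>\<beta>\<bar>) + (\<bar>\<alpha>'\<bar> + \<bar>\<beta>'\<bar>)) ((\<alpha> - \<beta>) + (\<alpha>' - \<beta>'))) =
     f 0 0 + (R - 1) * (f 2 2 + f 2 (- 2)) + 4 * (R - 1) * f 2 0 + (R - 1)\<^sup>2 / 2 * (f 3 3 + f 3 (- 3)) +
     (R - 1) * (3 * R - 7) / 2 * (f 3 1 + f 3 (- 1)) + (R - 1) ^ 3 / 16 * (f 4 4 + f 4 (- 4)) +
     (R - 1) * (R\<^sup>2 - 4 * R + 3) / 4 * (f 4 2 + f 4 (- 2)) +
     (R - 1) * (3 * R\<^sup>2 - 6 * R + 11) / 8 * f 4 0"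
proof -
  define A where "A = (R - 1) / 4"
  have R: "R = 4 * A + 1" by (simp add: A_def field_simps)
  have co: "(R - 1)\<^sup>2 / 2 = 8 * A ^ 2" "(R - 1) * (3 * R - 7) / 2 = 24 * A ^ 2 - 8 * A"
    "(R - 1) ^ 3 / 16 = 4 * A ^ 3" "(R - 1) * (R\<^sup>2 - 4 * R + 3) / 4 = 16 * A ^ 3 - 8 * A ^ 2"
    "(R - 1) * (3 * R\<^sup>2 - 6 * R + 11) / 8 = 24 * A ^ 3 + 4 * A"
    by (simp_all add: R field_simps power2_eq_square power3_eq_cube)
  have k0_in: "pair_sum (4 * A + 1) 0 (\<lambda>\<alpha>' \<beta>'. f (z + (\<bar>\<alpha>'\<bar> + \<bar>\<beta>'\<bar>)) (s + (\<alpha>' - \<beta>'))) =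
      f z s + 4 * A * f (z + 2) s" for z s
    using pair_sum_odd(1)[of A "\<lambda>u v. f (z + u) (s + v)"] by (simp add: algebra_simps)
  have k0: "pair_sum (4 * A + 1) 0 (\<lambda>\<alpha> \<beta>. pair_sum (4 * A + 1) 0 (\<lambda>\<alpha>' \<beta>'. f ((\<bar>\<alpha>\<bar> + \<bar>\<beta>\<bar>) + (\<bar>\<alpha>'\<bar> + \<bar>\<beta>'\<bar>)) ((\<alpha> - \<beta>) + (\<alpha>' - \<beta>')))) =
       (f 0 0 + 4 * A * f 2 0) +
       4 * A * (f 2 0 + 4 * A * f 4 0)"
    unfolding k0_in using pair_sum_odd(1)[of A "\<lambda>z s. f z s + 4 * A * f (z + 2) s"] by simp
  have k1_in: "pair_sum (4 * A + 1) 1 (\<lambda>\<alpha>' \<beta>'. f (z + (\<bar>\<alpha>'\<bar> + \<bar>\<beta>'\<bar>)) (s + (\<alpha>' - \<beta>'))) =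
      f (z + 1) (s + 1) + f (z + 1) (s - 1) + (2 * A - 1) * f (z + 2) s + A * f (z + 2) (s + 2) + A * f (z + 2) (s - 2)" for z s
    using pair_sum_odd(2)[of 1 A "\<lambda>u v. f (z + u) (s + v)"] by (simp add: algebra_simps)
  have k1: "pair_sum (4 * A + 1) 1 (\<lambda>\<alpha> \<beta>. pair_sum (4 * A + 1) 1 (\<lambda>\<alpha>' \<beta>'. f ((\<bar>\<alpha>\<bar> + \<bar>\<beta>\<bar>) + (\<bar>\<alpha>'\<bar> + \<bar>\<beta>'\<bar>)) ((\<alpha> - \<beta>) + (\<alpha>' - \<beta>')))) =
       (f 2 2 + f 2 0 + (2 * A - 1) * f 3 1 + A * f 3 3 + A * f 3 (- 1)) +
       (f 2 0 + f 2 (- 2) + (2 * A - 1) * f 3 (- 1) + A * f 3 1 + A * f 3 (- 3)) +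
       (2 * A - 1) * (f 3 1 + f 3 (- 1) + (2 * A - 1) * f 4 0 + A * f 4 2 + A * f 4 (- 2)) +
       A * (f 3 3 + f 3 1 + (2 * A - 1) * f 4 2 + A * f 4 4 + A * f 4 0) +
       A * (f 3 (- 1) + f 3 (- 3) + (2 * A - 1) * f 4 (- 2) + A * f 4 0 + A * f 4 (- 4))"
    unfolding k1_in using pair_sum_odd(2)[of 1 A "\<lambda>z s. f (z + 1) (s + 1) + f (z + 1) (s - 1) + (2 * A - 1) * f (z + 2) s + A * f (z + 2) (s + 2) + A * f (z + 2) (s - 2)"] by simp
  have km_in: "pair_sum (4 * A + 1) (- 1) (\<lambda>\<alpha>' \<beta>'. f (z + (\<bar>\<alpha>'\<bar> + \<bar>\<beta>'\<bar>)) (s + (\<alpha>' - \<beta>'))) =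
      f (z + 1) (s + 1) + f (z + 1) (s - 1) + (2 * A - 1) * f (z + 2) s + A * f (z + 2) (s + 2) + A * f (z + 2) (s - 2)" for z s
    using pair_sum_odd(2)[of "- 1" A "\<lambda>u v. f (z + u) (s + v)"] by (simp add: algebra_simps)
  have km: "pair_sum (4 * A + 1) (- 1) (\<lambda>\<alpha> \<beta>. pair_sum (4 * A + 1) (- 1) (\<lambda>\<alpha>' \<beta>'. f ((\<bar>\<alpha>\<bar> + \<bar>\<beta>\<bar>) + (\<bar>\<alpha>'\<bar> + \<bar>\<beta>'\<bar>)) ((\<alpha> - \<beta>) + (\<alpha>' - \<beta>')))) =
       (f 2 2 + f 2 0 + (2 * A - 1) * f 3 1 + A * f 3 3 + A * f 3 (- 1)) +
       (f 2 0 + f 2 (- 2) + (2 * A - 1) * f 3 (- 1) + A * f 3 1 + A * f 3 (- 3)) +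
       (2 * A - 1) * (f 3 1 + f 3 (- 1) + (2 * A - 1) * f 4 0 + A * f 4 2 + A * f 4 (- 2)) +
       A * (f 3 3 + f 3 1 + (2 * A - 1) * f 4 2 + A * f 4 4 + A * f 4 0) +
       A * (f 3 (- 1) + f 3 (- 3) + (2 * A - 1) * f 4 (- 2) + A * f 4 0 + A * f 4 (- 4))"
    unfolding km_in using pair_sum_odd(2)[of "- 1" A "\<lambda>z s. f (z + 1) (s + 1) + f (z + 1) (s - 1) + (2 * A - 1) * f (z + 2) s + A * f (z + 2) (s + 2) + A * f (z + 2) (s - 2)"] by simp
  have "quad_sum R (\<lambda>\<alpha> \<beta> \<alpha>' \<beta>'. f ((\<bar>\<alpha>\<bar> + \<bar>\<beta>\<bar>) + (\<bar>\<alpha>'\<bar> + \<bar>\<beta>'\<bar>)) ((\<alpha> - \<beta>) + (\<alpha>' - \<beta>'))) =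
     f 0 0 + 4 * A * (f 2 2 + f 2 (- 2)) + 16 * A * f 2 0 + 8 * A ^ 2 * (f 3 3 + f 3 (- 3)) +
     (24 * A ^ 2 - 8 * A) * (f 3 1 + f 3 (- 1)) + 4 * A ^ 3 * (f 4 4 + f 4 (- 4)) +
     (16 * A ^ 3 - 8 * A ^ 2) * (f 4 2 + f 4 (- 2)) + (24 * A ^ 3 + 4 * A) * f 4 0"
    unfolding quad_sum_def R
    by (simp add: class_num_def k0 k1 km) (simp add: algebra_simps power2_eq_square power3_eq_cube)
  moreover have "4 * (R - 1) = 16 * A" "R - 1 = 4 * A" by (simp_all add: R)
  ultimately show ?thesis unfolding co by simp
qed

section \<open>Counting pairs and quadruples of field elements by quadratic class\<close>

lemma qchar_in: "qchar x \<in> {- 1, 0, 1}"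
  using qchar_cases[of x] by auto

context primitive_extension
begin

definition pair_count :: "int \<Rightarrow> int \<Rightarrow> 'f \<Rightarrow> nat" where
  "pair_count \<alpha> \<beta> w = card {v. qchar v = \<alpha> \<and> qchar (w - v) = \<beta>}"

lemma pair_count_commute: "pair_count \<alpha> \<beta> w = pair_count \<beta> \<alpha> w"
proof -
  have "bij_betw (\<lambda>v. w - v) {v. qchar v = \<alpha> \<and> qchar (w - v) = \<beta>} {v. qchar v = \<beta> \<and> qchar (w - v) = \<alpha>}"
    by (rule bij_betwI[where g = "\<lambda>v. w - v"]) auto
  thus ?thesis unfolding pair_count_def by (rule bij_betw_same_card)
qed

text \<open>Division by w multiplies both classes by \<open>qchar w\<close>, which is its own
  inverse.\<close>

lemma pair_count_scale:
  assumes "w \<noteq> 0"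
  shows "pair_count \<alpha> \<beta> w = pair_count (qchar w * \<alpha>) (qchar w * \<beta>) 1"
proof -
  have eq: "qchar (w * z) = \<epsilon> \<longleftrightarrow> qchar z = qchar w * \<epsilon>" for z \<epsilon>
    using qchar_cases[of w] assms by (auto simp: qchar_mult)
  have "w - w * z = w * (1 - z)" for z by (simp add: right_diff_distrib)
  thus ?thesis
    using card_mult_left[OF assms, of "\<lambda>v. qchar v = \<alpha> \<and> qchar (w - v) = \<beta>"]
    by (simp add: pair_count_def eq)
qed

text \<open>The inversion \<open>v \<mapsto> 1 / v\<close> sends \<open>1 - v\<close> to \<open>- (1 - v) / v\<close>.\<close>
lemma pair_count_inverse: "pair_count (- 1) 1 1 = pair_count (- 1) (- 1) 1"
proof -
  have "qchar (1 - 1 / v) = qchar (1 - v) * qchar v" if "v \<noteq> 0" for v :: 'f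
  proof -
    have "1 - 1 / v = - ((1 - v) / v)" using that by (simp add: field_simps)
    thus ?thesis by (simp only: qchar_uminus qchar_divide)
  qed
  moreover have "v \<noteq> 0" if "qchar v = - 1" for v :: 'f using that by auto
  ultimately have "bij_betw (\<lambda>v. 1 / v) {v::'f. qchar v = - 1 \<and> qchar (1 - v) = 1}
      {v. qchar v = - 1 \<and> qchar (1 - v) = - 1}"
    by (intro bij_betwI[where g = "\<lambda>v. 1 / v"]) (auto simp: qchar_divide qchar_1)
  thus ?thesis unfolding pair_count_def by (rule bij_betw_same_card)
qed

lemma pair_count_sum:
  "card {v::'f. qchar v = \<alpha>} = pair_count \<alpha> 0 w + pair_count \<alpha> 1 w + pair_count \<alpha> (- 1) w"
proof -
  let ?X = "\<lambda>\<beta>. {v::'f. qchar v = \<alpha> \<and> qchar (w - v) = \<beta>}"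
  have "{v::'f. qchar v = \<alpha>} = ?X 0 \<union> (?X 1 \<union> ?X (- 1))"
    using qchar_cases by blast
  hence "card {v::'f. qchar v = \<alpha>} = card (?X 0 \<union> (?X 1 \<union> ?X (- 1)))" by (rule arg_cong)
  also have "\<dots> = card (?X 0) + card (?X 1 \<union> ?X (- 1))" by (rule card_Un_disjoint) auto
  also have "card (?X 1 \<union> ?X (- 1)) = card (?X 1) + card (?X (- 1))" by (rule card_Un_disjoint) auto
  finally show ?thesis by (simp add: pair_count_def)
qed

lemma pair_count_zero_left: "pair_count 0 \<beta> w = (if qchar w = \<beta> then 1 else 0)"
proof -
  have "{v. qchar v = 0 \<and> qchar (w - v) = \<beta>} = (if qchar w = \<beta> then {0} else {})" by auto
  thus ?thesis by (simp add: pair_count_def)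
qed

text \<open>Two row sums, the symmetry and the inversion are four linear relations for the four
  numbers. The case v = 1, where 1 - v = 0, takes one element from the first row; hence r - 5
  instead of r - 1.\<close>

lemma pair_count_1:
  "real (pair_count 1 1 1) = (real r - 5) / 4"
  "real (pair_count 1 (- 1) 1) = (real r - 1) / 4"
  "real (pair_count (- 1) 1 1) = (real r - 1) / 4"
  "real (pair_count (- 1) (- 1) 1) = (real r - 1) / 4"
proof -
  have z: "pair_count 1 0 1 = 1" "pair_count (- 1) 0 1 = 0"
    by (simp_all add: pair_count_commute[of _ 0] pair_count_zero_left qchar_1)
  have "(real r - 1) / 2 = 1 + real (pair_count 1 1 1) + real (pair_count 1 (- 1) 1)"
    "(real r - 1) / 2 = real (pair_count (- 1) 1 1) + real (pair_count (- 1) (- 1) 1)"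
    using arg_cong[OF pair_count_sum[of 1 1], of real] arg_cong[OF pair_count_sum[of "- 1" 1], of real]
    by (simp_all add: z card_qchar)
  moreover have "pair_count 1 (- 1) 1 = pair_count (- 1) 1 1" by (rule pair_count_commute)
  moreover note pair_count_inverse
  ultimately show "real (pair_count 1 1 1) = (real r - 5) / 4"
    "real (pair_count 1 (- 1) 1) = (real r - 1) / 4"
    "real (pair_count (- 1) 1 1) = (real r - 1) / 4"
    "real (pair_count (- 1) (- 1) 1) = (real r - 1) / 4" by (simp_all add: field_simps)
qed

lemma card_qchar_class: "\<alpha> \<in> {- 1, 0, 1} \<Longrightarrow> real (card {v::'f. qchar v = \<alpha>}) = class_num r \<alpha>"
  using card_qchar by (auto simp: class_num_def)

lemma pair_count_eq:
  assumes "\<alpha> \<in> {- 1, 0, 1}" "\<beta> \<in> {- 1, 0, 1}"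
  shows "real (pair_count \<alpha> \<beta> w) = pair_num r (qchar w) \<alpha> \<beta>"
proof (cases "w = 0")
  case True
  \<comment> \<open>As -1 is a square, v and -v have the same class.\<close>
  have "pair_count \<alpha> \<beta> 0 = (if \<alpha> = \<beta> then card {v::'f. qchar v = \<alpha>} else 0)"
    by (auto simp: pair_count_def qchar_uminus intro!: arg_cong[of _ _ card])
  thus ?thesis using True card_qchar_class[OF assms(1)] by (cases "\<alpha> = \<beta>") (simp_all add: pair_num_def class_num_def)
next
  case False
  have eq: "real (pair_count \<alpha> \<beta> w) = real (pair_count (qchar w * \<alpha>) (qchar w * \<beta>) 1)"
    using pair_count_scale[OF False] by simp
  have z: "pair_count 1 0 1 = 1" "pair_count (- 1) 0 1 = 0"
    by (simp_all add: pair_count_commute[of _ 0] pair_count_zero_left qchar_1)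
  have "qchar w = 1 \<or> qchar w = - 1" using qchar_cases[of w] False by auto
  thus ?thesis using assms unfolding eq
    by (elim insertE emptyE disjE)
       (simp_all only: pair_num_def, simp_all add: pair_count_1 pair_count_zero_left qchar_1 z)
qed

lemma sum_qchar: "(\<Sum>w\<in>UNIV. h (qchar (w::'f))) = (\<Sum>k\<in>{- 1, 0, 1}. class_num r k * h k)" for h :: "int \<Rightarrow> real"
proof -
  have "(\<Sum>w\<in>UNIV. h (qchar (w::'f))) = (\<Sum>k\<in>{- 1, 0, 1}. \<Sum>w | w \<in> UNIV \<and> qchar w = k. h (qchar (w::'f)))"
  proof (rule sum.group[symmetric])
    show "qchar ` (UNIV :: 'f set) \<subseteq> {- 1, 0, 1}" by (rule image_subsetI) (rule qchar_in)
  qed simp_all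
  also have "\<dots> = (\<Sum>k\<in>{- 1, 0, 1}. class_num r k * h k)"
  proof (rule sum.cong)
    fix k :: int assume k: "k \<in> {- 1, 0, 1}"
    have "(\<Sum>w | w \<in> UNIV \<and> qchar w = k. h (qchar (w::'f))) = (\<Sum>w\<in>{w::'f. qchar w = k}. h k)"
      by (rule sum.cong) auto
    thus "(\<Sum>w | w \<in> UNIV \<and> qchar w = k. h (qchar (w::'f))) = class_num r k * h k"
      using card_qchar_class[OF k] by simp
  qed simp
  finally show ?thesis .
qed

lemma sum_qchar_pair:
  "(\<Sum>v\<in>UNIV. H (qchar v) (qchar (w - v))) =
     pair_sum r (qchar w) H" for H :: "int \<Rightarrow> int \<Rightarrow> real" and w :: 'f
proof -
  let ?c = "\<lambda>v. (qchar v, qchar (w - v))"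
  have "(\<Sum>v\<in>UNIV. H (qchar v) (qchar (w - v))) =
      (\<Sum>x\<in>{- 1, 0, 1} \<times> {- 1, 0, 1}. \<Sum>v | v \<in> UNIV \<and> ?c v = x. H (qchar v) (qchar (w - v)))"
  proof (rule sum.group[symmetric])
    show "?c ` UNIV \<subseteq> {- 1, 0, 1} \<times> {- 1, 0, 1}" by (rule image_subsetI) (rule SigmaI; rule qchar_in)
  qed simp_all
  also have "\<dots> = (\<Sum>x\<in>{- 1, 0, 1} \<times> {- 1, 0, 1}. pair_num r (qchar w) (fst x) (snd x) * H (fst x) (snd x))"
  proof (rule sum.cong)
    fix x :: "int \<times> int" assume x: "x \<in> {- 1, 0, 1} \<times> {- 1, 0, 1}"
    have "(\<Sum>v | v \<in> UNIV \<and> ?c v = x. H (qchar v) (qchar (w - v))) =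
        (\<Sum>v\<in>{v. qchar v = fst x \<and> qchar (w - v) = snd x}. H (fst x) (snd x))"
      by (rule sum.cong) auto
    also have "\<dots> = real (pair_count (fst x) (snd x) w) * H (fst x) (snd x)"
      by (simp add: pair_count_def)
    finally show "(\<Sum>v | v \<in> UNIV \<and> ?c v = x. H (qchar v) (qchar (w - v))) =
        pair_num r (qchar w) (fst x) (snd x) * H (fst x) (snd x)"
      using x pair_count_eq[of "fst x" "snd x" w] by (metis mem_Times_iff)
  qed simp
  finally show ?thesis by (simp only: pair_sum_def sum.cartesian_product split_def)
qed

text \<open>A quadruple with sum zero consists of a pair with sum w and a pair with sum -w. Both
  sums have the same class, so one k serves both inner sums.\<close>

lemma sum_qchar_quadruple:
  "(\<Sum>w\<in>UNIV. \<Sum>v\<in>UNIV. \<Sum>v'\<in>UNIV. G (qchar v) (qchar (w - v)) (qchar v') (qchar (- w - v' :: 'f))) = quad_sum r G"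
proof -
  have "(\<Sum>v'\<in>UNIV. H (qchar v') (qchar (- w - v'))) = pair_sum r (qchar w) H" for H and w :: 'f
    using sum_qchar_pair[of H "- w"] by (simp only: qchar_uminus)
  thus ?thesis
    using sum_qchar[of "\<lambda>k. pair_sum r k (\<lambda>\<alpha> \<beta>. pair_sum r k (G \<alpha> \<beta>))"]
    by (simp only: quad_sum_def sum_qchar_pair[of "\<lambda>\<alpha> \<beta>. pair_sum r _ (G \<alpha> \<beta>)"])
qed

end

section \<open>The code\<close>

text \<open>A basis B identifies C with the functions from B to the base field. The dimension can
  thus be read off from the number of codewords, without exhibiting a basis of the code.\<close>

lemma card_eq_power_dim:
  fixes C :: "'k::{field,finite} vec set"
  assumes "finite C" and sub: "VectorSpace.subspace class_ring C (module_vec TYPE('k) n)"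
  shows "card C = CARD('k) ^ vectorspace.dim class_ring ((module_vec TYPE('k) n)\<lparr>carrier := C\<rparr>)"
proof -
  interpret V: vec_space "TYPE('k)" n .
  let ?W = "(module_vec TYPE('k) n)\<lparr>carrier := C\<rparr>"
  interpret W: vectorspace class_ring ?W
    using sub by (rule V.subspace_is_vs)
  have "W.span C = C"
    using W.span_is_subset2[of C] W.in_own_span[of C] by auto
  hence "W.fin_dim" unfolding W.fin_dim_def using \<open>finite C\<close> by (intro exI[of _ C]) simp
  then obtain B where B: "finite B" "W.basis B" using W.finite_basis_exists by blast
  hence BC: "B \<subseteq> carrier ?W" unfolding W.basis_def by auto
  have dim: "W.dim = card B" using B by (rule W.dim_basis)
  have uniq: "\<exists>!a. a \<in> B \<rightarrow>\<^sub>E carrier class_ring \<and> W.lincomb a B = v" if "v \<in> C" for v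
    using W.basis_criterion[OF B(1) BC] B(2) that by simp
  have "bij_betw (\<lambda>a. W.lincomb a B) (B \<rightarrow>\<^sub>E (UNIV :: 'k set)) C"
  proof (rule bij_betw_imageI)
    have closed: "W.lincomb a B \<in> C" if "a \<in> B \<rightarrow>\<^sub>E UNIV" for a
      using W.lincomb_closed[OF BC, of a] by simp
    show "inj_on (\<lambda>a. W.lincomb a B) (B \<rightarrow>\<^sub>E UNIV)"
    proof (rule inj_onI)
      fix a a' assume "a \<in> B \<rightarrow>\<^sub>E (UNIV :: 'k set)" "a' \<in> B \<rightarrow>\<^sub>E (UNIV :: 'k set)" "W.lincomb a B = W.lincomb a' B"
      thus "a = a'" using uniq[OF closed, of a] by (auto simp: class_ring_simps)
    qed
    show "(\<lambda>a. W.lincomb a B) ` (B \<rightarrow>\<^sub>E UNIV) = C"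
    proof
      show "C \<subseteq> (\<lambda>a. W.lincomb a B) ` (B \<rightarrow>\<^sub>E UNIV)"
      proof
        fix v assume "v \<in> C"
        then obtain a where "a \<in> B \<rightarrow>\<^sub>E UNIV" "W.lincomb a B = v"
          using uniq[of v] by (auto simp: class_ring_simps)
        thus "v \<in> (\<lambda>a. W.lincomb a B) ` (B \<rightarrow>\<^sub>E UNIV)" by blast
      qed
    qed (use closed in blast)
  qed
  hence "card C = card (B \<rightarrow>\<^sub>E (UNIV :: 'k set))" by (simp add: bij_betw_same_card)
  also have "\<dots> = CARD('k) ^ card B" using B(1) by (simp add: card_PiE)
  finally show ?thesis by (simp add: dim)
qed

lemma sum_lessThan_periodic:
  fixes g :: "nat \<Rightarrow> nat"
  assumes "\<And>i. g (i + n) = g i"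
  shows "(\<Sum>i<d * n. g i) = d * (\<Sum>i<n. g i)"
proof (induction d)
  case (Suc d)
  have per: "g (d * n + i) = g i" for i
  proof (induction d)
    case (Suc d)
    have "g (Suc d * n + i) = g (d * n + i + n)" by (simp add: algebra_simps)
    thus ?case using assms Suc by simp
  qed simp
  have "(\<Sum>i<k + l. g i) = (\<Sum>i<k. g i) + (\<Sum>i<l. g (k + i))" for k l
    by (induction l) auto
  from this[of "d * n" n] have "(\<Sum>i<Suc d * n. g i) = (\<Sum>i<d * n. g i) + (\<Sum>i<n. g (d * n + i))"
    by (simp add: add.commute)
  thus ?case using Suc by (simp add: per)
qed simp

lemma sum_lessThan_mod_4:
  fixes g :: "nat \<Rightarrow> nat"
  shows "(\<Sum>i<4 * n. g i) = (\<Sum>h<4. \<Sum>i<n. g (4 * i + h))"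
proof (induction n)
  case (Suc n)
  have "4 * Suc n = Suc (Suc (Suc (Suc (4 * n))))" by simp
  hence "(\<Sum>i<4 * Suc n. g i) = (\<Sum>i<4 * n. g i) + (\<Sum>h<4. g (4 * n + h))"
    by (simp only: sum.lessThan_Suc) (simp add: numeral_eq_Suc)
  thus ?case using Suc by (simp add: sum.distrib)
qed simp

lemma root_of_unity_4_sum:
  fixes z :: "'a::field"
  assumes "z ^ 4 = 1" "z \<noteq> 1"
  shows "1 + z + z ^ 2 + z ^ 3 = 0"
proof -
  have "(z - 1) * (1 + z + z ^ 2 + z ^ 3) = z ^ 4 - 1" by (simp add: algebra_simps numeral_eq_Suc)
  thus ?thesis using assms by simp
qed

section \<open>The codewords and their weights as orbit counts\<close>

locale three_term_code = primitive_extension emb p s m q r \<gamma>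
  for emb :: "'k::{field,finite} \<Rightarrow> 'f::{field,finite}" and p s m q r and \<gamma> :: 'f +
  fixes a :: int and \<Delta> b :: "nat \<Rightarrow> int" and \<delta> n :: nat
  assumes gcd_index: "gcd (int ((r - 1) div (q - 1))) (a * 4) = 2"
    and \<Delta>_incong: "\<And>i j. i \<in> {1..3} \<Longrightarrow> j \<in> {1..3} \<Longrightarrow> i \<noteq> j \<Longrightarrow> \<not> [\<Delta> i = \<Delta> j] (mod 4)"
    and b_cong: "\<And>i. i \<in> {1..3} \<Longrightarrow> [b i = a + int ((r - 1) div 4) * \<Delta> i] (mod int (r - 1))"
    and \<delta>_eq: "\<delta> = nat (Gcd (insert (int (r - 1)) (b ` {1..3})))"
    and n_eq: "n = (r - 1) div \<delta>"
begin

text \<open>Triples replace the functions on \<open>nat\<close> in \<open>trace_code\<close>, of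
  which only the values at 1, 2, 3 enter. They form a finite type, over which one can sum, and allow
  the encoding to be injective.\<close>

fun val :: "'f \<times> 'f \<times> 'f \<Rightarrow> nat \<Rightarrow> 'f" where
  "val (x, y, z) i = x * \<gamma> powi (b 1 * int i) + y * \<gamma> powi (b 2 * int i) + z * \<gamma> powi (b 3 * int i)"

definition codeword :: "'f \<times> 'f \<times> 'f \<Rightarrow> 'k vec" where
  "codeword x = vec n (\<lambda>i. Tr (val x i))"

lemma trace_code_eq: "trace_code emb m \<gamma> n 3 b = range codeword"
proof -
  have s3: "(\<Sum>j=Suc 0..3. f j) = f (Suc 0) + f 2 + f 3" for f :: "nat \<Rightarrow> 'f"
    by (simp add: numeral_eq_Suc)
  have "vec n (\<lambda>i. Tr (\<Sum>j=1..3. x j * \<gamma> powi (b j * int i))) = codeword (x 1, x 2, x 3)" for x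
    by (simp add: codeword_def s3)
  moreover have "\<exists>x::nat \<Rightarrow> 'f. y = (x 1, x 2, x 3)" for y
    by (intro exI[of _ "\<lambda>j. if j = 1 then fst y else if j = 2 then fst (snd y) else snd (snd y)"]) simp
  ultimately show ?thesis unfolding trace_code_def by (auto simp: image_iff) metis+
qed

lemma \<delta>_dvd: "\<delta> dvd r - 1" "i \<in> {1..3} \<Longrightarrow> int \<delta> dvd b i"
proof -
  have nn: "Gcd (insert (int (r - 1)) (b ` {1..3})) \<ge> 0" by (rule Gcd_int_greater_eq_0)
  hence d: "int \<delta> = Gcd (insert (int (r - 1)) (b ` {1..3}))" by (simp add: \<delta>_eq)
  have "int \<delta> dvd int (r - 1)" unfolding d by (rule Gcd_dvd) simp
  thus "\<delta> dvd r - 1" by (simp only: int_dvd_int_iff)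
  show "int \<delta> dvd b i" if "i \<in> {1..3}" unfolding d by (rule Gcd_dvd) (use that in simp)
qed

lemma \<delta>_mult_n: "\<delta> * n = r - 1"
  using \<delta>_dvd(1) by (simp add: n_eq)

lemma \<delta>_pos: "\<delta> > 0" and n_pos: "n > 0"
  using \<delta>_mult_n card_gt_1 by (metis One_nat_def mult_is_0 not_gr0 zero_less_diff not_less_zero)+

lemma powi_b_n:
  assumes "i \<in> {1..3}"
  shows "\<gamma> powi (b i * int n) = 1"
proof -
  obtain c where "b i = int \<delta> * c" using \<delta>_dvd(2)[OF assms] by blast
  hence "b i * int n = int (\<delta> * n) * c" by simp
  thus ?thesis unfolding \<delta>_mult_n by simp
qed

lemma powi_b_add_n: "i \<in> {1..3} \<Longrightarrow> \<gamma> powi (b i * int (k + n)) = \<gamma> powi (b i * int k)"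
  using powi_b_n[of i] by (simp add: distrib_left power_int_add)

lemma val_periodic: "val x (i + n) = val x i"
  by (cases x) (simp add: powi_b_add_n del: of_nat_add)

lemma val_mod: "val x (i mod n) = val x i"
proof -
  have "val x (i + k * n) = val x i" for i k
  proof (induction k)
    case (Suc k)
    have "val x (i + Suc k * n) = val x (i + k * n + n)" by (simp add: ac_simps)
    thus ?case using Suc val_periodic by simp
  qed simp
  from this[of "i mod n" "i div n"] show ?thesis by simp
qed

lemma order_eq: "int (r - 1) = 4 * int ((r - 1) div 4)"
  using four_dvd by (metis dvd_mult_div_cancel of_nat_mult of_nat_numeral)

text \<open>Four times (r - 1)/4 vanishes modulo r - 1, so 4 b_j \<equiv> 4 a for every j: along
  each residue class modulo 4 all three terms grow by the same ratio \<gamma>^(4 a).\<close>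

lemma val_decimate: "val x (4 * i + h) = val x h * \<gamma> powi (a * 4 * int i)"
proof -
  have "\<gamma> powi (b j * int (4 * i + h)) = \<gamma> powi (b j * int h) * \<gamma> powi (a * 4 * int i)" if j: "j \<in> {1..3}" for j
  proof -
    obtain c where "b j = a + int ((r - 1) div 4) * \<Delta> j + int (r - 1) * c"
      using b_cong[OF j] by (metis cong_iff_lin cong_sym)
    hence "b j * int (4 * i + h) = b j * int h + a * 4 * int i + int (r - 1) * ((\<Delta> j + 4 * c) * int i)"
      using order_eq by (simp add: ring_distribs)
    thus ?thesis by (simp add: power_int_add)
  qed
  thus ?thesis by (cases x) (simp add: algebra_simps del: of_nat_add of_nat_mult)
qed

text \<open>Repeating the word 4 \<delta> times gives length 4 (r - 1), so every residue class
  modulo 4 has the r - 1 indices that \<open>orbit_count\<close> expects, without having to know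
  that 4 divides n.\<close>

lemma hamming_weight_orbit_count:
  "4 * \<delta> * hamming_weight (codeword x) = (\<Sum>h<4. orbit_count (a * 4) (val x h))"
proof -
  define g :: "nat \<Rightarrow> nat" where "g i = of_bool (Tr (val x i) \<noteq> 0)" for i
  have "hamming_weight (codeword x) = card {i\<in>{..<n}. Tr (val x i) \<noteq> 0}"
    unfolding hamming_weight_def by (rule arg_cong[of _ _ card]) (auto simp: codeword_def)
  also have "\<dots> = (\<Sum>i<n. g i)" by (simp add: g_def of_bool_def sum.If_cases Int_def)
  finally have "4 * \<delta> * hamming_weight (codeword x) = (\<Sum>i<4 * \<delta> * n. g i)"
    using sum_lessThan_periodic[of g n "4 * \<delta>"] by (simp add: g_def val_periodic)
  also have "4 * \<delta> * n = 4 * (r - 1)" using \<delta>_mult_n by simp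
  also have "(\<Sum>i<4 * (r - 1). g i) = (\<Sum>h<4. \<Sum>i<r - 1. g (4 * i + h))" by (rule sum_lessThan_mod_4)
  also have "\<dots> = (\<Sum>h<4. orbit_count (a * 4) (val x h))"
    by (simp add: g_def val_decimate orbit_count_def)
  finally show ?thesis .
qed

section \<open>Fourth roots of unity and the Fourier transform of length 4\<close>

definition \<omega> :: 'f where "\<omega> = \<gamma> powi int ((r - 1) div 4)"

lemma \<omega>_powi: "\<omega> powi k = \<gamma> powi (int ((r - 1) div 4) * k)"
  unfolding \<omega>_def by (rule power_int_mult[symmetric])

lemma \<omega>_powi_4: "(\<omega> powi k) ^ 4 = 1"
proof -
  have "(\<omega> powi k) ^ 4 = \<gamma> powi (int ((r - 1) div 4) * k * 4)"
    by (simp add: \<omega>_powi power_int_mult)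
  also have "int ((r - 1) div 4) * k * 4 = int (r - 1) * k" using order_eq by simp
  finally show ?thesis by simp
qed

text \<open>Together with \<open>\<omega>_powi_4\<close> this says that \<omega> is a primitive
  fourth root of unity.\<close>

lemma \<omega>_powi_eq_1: "\<omega> powi k = 1 \<Longrightarrow> [k = 0] (mod 4)"
proof -
  assume "\<omega> powi k = 1"
  hence "int (r - 1) dvd int ((r - 1) div 4) * k"
    by (simp only: \<omega>_powi powi_eq_1_iff)
  hence "4 * int ((r - 1) div 4) dvd int ((r - 1) div 4) * k" by (simp only: order_eq)
  moreover have "int ((r - 1) div 4) \<noteq> 0" using order_eq card_gt_1 by linarith
  ultimately have "4 dvd k" by (simp add: mult.commute)
  thus ?thesis by (simp add: cong_0_iff)
qed

lemma missing_residue: "\<exists>d. \<forall>i\<in>{1..3}. \<not> [\<Delta> i = d] (mod 4)"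
proof -
  have "card ((\<lambda>i. \<Delta> i mod 4) ` {1..3}) \<le> 3" using card_image_le[of "{1..3::nat}" "\<lambda>i. \<Delta> i mod 4"] by simp
  hence "\<not> {0..<4} \<subseteq> (\<lambda>i. \<Delta> i mod 4) ` {1..3}"
    using card_mono[of "(\<lambda>i. \<Delta> i mod 4) ` {1..3}" "{0..<4::int}"] by auto
  then obtain d :: int where "d \<in> {0..<4}" "d \<notin> (\<lambda>i. \<Delta> i mod 4) ` {1..3}" by blast
  thus ?thesis by (intro exI[of _ d]) (auto simp: cong_def)
qed

definition d0 :: int where "d0 = (SOME d. \<forall>i\<in>{1..3}. \<not> [\<Delta> i = d] (mod 4))"

lemma d0: "i \<in> {1..3} \<Longrightarrow> \<not> [\<Delta> i = d0] (mod 4)"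
  using someI_ex[OF missing_residue] unfolding d0_def by blast

text \<open>Subtracting \<open>d0\<close> moves the missing frequency to 0. The three values for i =
  1, 2, 3 are then the fourth roots of unity other than 1, which is why the transform has sum
  zero.\<close>

definition \<zeta> :: "nat \<Rightarrow> 'f" where "\<zeta> i = \<omega> powi (\<Delta> i - d0)"

lemma \<zeta>_4: "\<zeta> i ^ 4 = 1"
  unfolding \<zeta>_def by (rule \<omega>_powi_4)

lemma \<zeta>_nonzero: "\<zeta> i \<noteq> 0"
  using \<zeta>_4[of i] by auto

lemma \<zeta>_neq_1: "i \<in> {1..3} \<Longrightarrow> \<zeta> i \<noteq> 1"
  using d0[of i] \<omega>_powi_eq_1[of "\<Delta> i - d0"] unfolding \<zeta>_def by (auto simp: cong_diff_iff_cong_0)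

lemma \<zeta>_inj: "i \<in> {1..3} \<Longrightarrow> j \<in> {1..3} \<Longrightarrow> i \<noteq> j \<Longrightarrow> \<zeta> i \<noteq> \<zeta> j"
proof
  assume ij: "i \<in> {1..3}" "j \<in> {1..3}" "i \<noteq> j" and "\<zeta> i = \<zeta> j"
  have "\<omega> \<noteq> 0" by (simp add: \<omega>_def power_int_not_zero)
  have "\<omega> powi (\<Delta> i - \<Delta> j) = \<omega> powi ((\<Delta> i - d0) - (\<Delta> j - d0))" by simp
  also have "\<dots> = \<zeta> i / \<zeta> j" unfolding \<zeta>_def using \<open>\<omega> \<noteq> 0\<close> by (subst power_int_diff) auto
  also have "\<dots> = 1" using \<open>\<zeta> i = \<zeta> j\<close> \<zeta>_nonzero by simp
  finally have "[\<Delta> i = \<Delta> j] (mod 4)" using \<omega>_powi_eq_1 cong_diff_iff_cong_0 by blast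
  thus False using \<Delta>_incong[OF ij] by blast
qed

fun dft :: "'f \<times> 'f \<times> 'f \<Rightarrow> nat \<Rightarrow> 'f" where
  "dft (x, y, z) h = x * \<zeta> 1 ^ h + y * \<zeta> 2 ^ h + z * \<zeta> 3 ^ h"

text \<open>The exponents b_j differ modulo r - 1 only in their multiple of (r - 1)/4, so a common
  power of \<gamma> splits off and leaves powers of fourth roots of unity.\<close>

lemma val_eq_dft: "val x h = \<gamma> powi ((a + int ((r - 1) div 4) * d0) * int h) * dft x h"
proof -
  have "\<gamma> powi (b j * int h) = \<gamma> powi ((a + int ((r - 1) div 4) * d0) * int h) * \<zeta> j ^ h" if j: "j \<in> {1..3}" for j
  proof -
    have "[b j * int h = (a + int ((r - 1) div 4) * \<Delta> j) * int h] (mod int (r - 1))"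
      using b_cong[OF j] by (rule cong_scalar_right)
    hence "\<gamma> powi (b j * int h) = \<gamma> powi ((a + int ((r - 1) div 4) * \<Delta> j) * int h)" by (rule powi_cong)
    also have "(a + int ((r - 1) div 4) * \<Delta> j) * int h =
        (a + int ((r - 1) div 4) * d0) * int h + int ((r - 1) div 4) * (\<Delta> j - d0) * int h"
      by (simp add: algebra_simps)
    also have "\<gamma> powi \<dots> = \<gamma> powi ((a + int ((r - 1) div 4) * d0) * int h) * \<zeta> j ^ h"
      by (simp add: power_int_add \<zeta>_def \<omega>_def power_int_mult[symmetric] flip: power_int_of_nat)
    finally show ?thesis .
  qed
  thus ?thesis by (cases x) (simp add: algebra_simps)
qed

lemma dft_sum: "dft x 0 + dft x 1 + dft x 2 + dft x 3 = 0"
proof -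
  have e: "1 + \<zeta> j + \<zeta> j ^ 2 + \<zeta> j ^ 3 = 0" if "j \<in> {1..3}" for j
    using root_of_unity_4_sum \<zeta>_4 \<zeta>_neq_1[OF that] by blast
  obtain u v w where x: "x = (u, v, w)" by (cases x)
  have "dft x 0 + dft x 1 + dft x 2 + dft x 3 = u * (1 + \<zeta> 1 + \<zeta> 1 ^ 2 + \<zeta> 1 ^ 3) +
      v * (1 + \<zeta> 2 + \<zeta> 2 ^ 2 + \<zeta> 2 ^ 3) + w * (1 + \<zeta> 3 + \<zeta> 3 ^ 2 + \<zeta> 3 ^ 3)"
    by (simp add: x algebra_simps)
  thus ?thesis using e[of 1] e[of 2] e[of 3] by simp
qed

lemma dft_3: "dft x 3 = - (dft x 0 + dft x 1) - dft x 2"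
proof -
  have "dft x 3 = (dft x 0 + dft x 1 + dft x 2 + dft x 3) + (- (dft x 0 + dft x 1) - dft x 2)" by simp
  thus ?thesis by (simp only: dft_sum add_0)
qed

lemma four_nonzero: "(4::'f) \<noteq> 0"
proof -
  have "(2::'f) \<noteq> 0" using neg_1_neq_1 by (metis add.inverse_unique one_add_one)
  hence "(2::'f) * 2 \<noteq> 0" by (simp only: mult_eq_0_iff) simp
  thus ?thesis by simp
qed

text \<open>Fourier inversion: for i \<noteq> j the ratio of the two roots is a fourth root of unity
  other than 1, whose first four powers sum to 0.\<close>

lemma dft_inverse:
  assumes "j \<in> {1..3}"
  shows "dft (x1, x2, x3) 0 + dft (x1, x2, x3) 1 / \<zeta> j + dft (x1, x2, x3) 2 / \<zeta> j ^ 2 +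
    dft (x1, x2, x3) 3 / \<zeta> j ^ 3 = 4 * (if j = 1 then x1 else if j = 2 then x2 else x3)"
proof -
  define c where "c i = 1 + \<zeta> i / \<zeta> j + (\<zeta> i / \<zeta> j) ^ 2 + (\<zeta> i / \<zeta> j) ^ 3" for i
  have c: "c i = (if i = j then 4 else 0)" if "i \<in> {1..3}" for i
  proof (cases "i = j")
    case True
    thus ?thesis using \<zeta>_nonzero by (simp add: c_def)
  next
    case False
    hence "\<zeta> i / \<zeta> j \<noteq> 1" using \<zeta>_inj[OF that assms] by auto
    moreover have "(\<zeta> i / \<zeta> j) ^ 4 = 1" by (simp only: power_divide \<zeta>_4) simp
    ultimately show ?thesis using False root_of_unity_4_sum[of "\<zeta> i / \<zeta> j"] by (simp add: c_def)
  qed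
  have "dft (x1, x2, x3) 0 + dft (x1, x2, x3) 1 / \<zeta> j + dft (x1, x2, x3) 2 / \<zeta> j ^ 2 +
    dft (x1, x2, x3) 3 / \<zeta> j ^ 3 = x1 * c 1 + x2 * c 2 + x3 * c 3"
    by (simp add: c_def algebra_simps add_divide_distrib power_divide)
  moreover have "j = 1 \<or> j = 2 \<or> j = 3" using assms by auto
  ultimately show ?thesis using c[of 1] c[of 2] c[of 3] by auto
qed

lemma dft_inj:
  assumes "\<And>h. h < 4 \<Longrightarrow> dft x h = dft y h"
  shows "x = y"
proof -
  obtain x1 x2 x3 y1 y2 y3 where x: "x = (x1, x2, x3)" and y: "y = (y1, y2, y3)"
    by (metis prod_cases3)
  have "4 * (if j = 1 then x1 else if j = 2 then x2 else x3) =
      4 * (if j = 1 then y1 else if j = 2 then y2 else y3)" if "j \<in> {1..3}" for j :: nat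
    unfolding dft_inverse[OF that, symmetric] using assms by (simp add: x y del: dft.simps)
  from this[of 1] this[of 2] this[of 3] show ?thesis using four_nonzero by (simp add: x y)
qed

text \<open>Injectivity suffices, as domain and codomain are the same finite type. The three
  coordinates are the w, v, v' of \<open>sum_qchar_quadruple\<close>.\<close>

lemma bij_dft: "bij (\<lambda>x. (dft x 0 + dft x 1, dft x 0, dft x 2))"
proof -
  have "inj (\<lambda>x. (dft x 0 + dft x 1, dft x 0, dft x 2))"
  proof (rule injI)
    fix x y assume *: "(dft x 0 + dft x 1, dft x 0, dft x 2) = (dft y 0 + dft y 1, dft y 0, dft y 2)"
    hence "dft x 3 = dft y 3" by (auto simp: dft_3)
    with * have "dft x h = dft y h" if "h \<in> {0, 1, 2, 3}" for h
      using that by auto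
    moreover have "h \<in> {0, 1, 2, 3}" if "h < 4" for h :: nat using that by auto
    ultimately show "x = y" using dft_inj by metis
  qed
  thus ?thesis by (simp add: bij_def finite_UNIV_inj_surj)
qed

lemma sum_dft:
  fixes G :: "int \<Rightarrow> int \<Rightarrow> int \<Rightarrow> int \<Rightarrow> real"
  shows "(\<Sum>x\<in>UNIV. G (qchar (dft x 0)) (qchar (dft x 1)) (qchar (dft x 2)) (qchar (dft x 3))) = quad_sum r G"
proof -
  define F :: "'f \<times> 'f \<times> 'f \<Rightarrow> real" where
    "F = (\<lambda>(w, v, v'). G (qchar v) (qchar (w - v)) (qchar v') (qchar (- w - v')))"
  have "(\<Sum>x\<in>UNIV. G (qchar (dft x 0)) (qchar (dft x 1)) (qchar (dft x 2)) (qchar (dft x 3))) =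
      (\<Sum>x\<in>UNIV. F (dft x 0 + dft x 1, dft x 0, dft x 2))"
    by (simp add: F_def dft_3)
  also have "\<dots> = (\<Sum>y\<in>UNIV. F y)" using bij_dft by (rule sum.reindex_bij_betw)
  also have "\<dots> = (\<Sum>w\<in>UNIV. \<Sum>v\<in>UNIV. \<Sum>v'\<in>UNIV. F (w, v, v'))"
    by (simp add: sum.cartesian_product)
  also have "\<dots> = quad_sum r G" unfolding F_def using sum_qchar_quadruple by simp
  finally show ?thesis .
qed

end

section \<open>Weights in terms of the support and the character sum\<close>

context three_term_code
begin

definition support :: "'f \<times> 'f \<times> 'f \<Rightarrow> int" where
  "support x = (\<bar>qchar (dft x 0)\<bar> + \<bar>qchar (dft x 1)\<bar>) + (\<bar>qchar (dft x 2)\<bar> + \<bar>qchar (dft x 3)\<bar>)"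

text \<open>For odd a the classes at odd positions are reversed by \<open>qchar_val\<close>. The
  bracketing into pairs matches \<open>quad_sum_even\<close> and
  \<open>quad_sum_odd\<close>.\<close>

definition char_sum :: "'f \<times> 'f \<times> 'f \<Rightarrow> int" where
  "char_sum x = (if even a
     then (qchar (dft x 0) + qchar (dft x 1)) + (qchar (dft x 2) + qchar (dft x 3))
     else (qchar (dft x 0) - qchar (dft x 1)) + (qchar (dft x 2) - qchar (dft x 3)))"

text \<open>The weight of a word with z nonzero transform values and, up to the unknown sign,
  character sum c. The factor 4 \<delta> is the repetition factor of
  \<open>hamming_weight_orbit_count\<close>.\<close>

definition wt :: "int \<Rightarrow> int \<Rightarrow> real" where
  "wt z c = (real q - 1) / (4 * real \<delta> * real q) * (real_of_int z * real r + real_of_int c * sqrt r)"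

text \<open>As 8 divides r - 1, the number (r - 1)/4 is even and \<open>d0\<close> does not
  influence the class; the exponent of the factor has the parity of a h.\<close>

lemma qchar_val: "qchar (val x h) = (if even a \<or> even h then 1 else - 1) * qchar (dft x h)"
proof -
  obtain j where "r - 1 = 8 * j" using eight_dvd by blast
  hence "even (int ((r - 1) div 4))" by simp
  thus ?thesis unfolding val_eq_dft qchar_mult qchar_powi by simp
qed

lemma val_eq_0_iff: "val x h = 0 \<longleftrightarrow> dft x h = 0"
  by (simp add: val_eq_dft power_int_not_zero)

lemma abs_qchar: "\<bar>qchar y\<bar> = of_bool (y \<noteq> 0)"
  by (simp add: qchar_def)

lemma hamming_weight_formula:
  "\<exists>\<kappa>::int. (\<kappa> = 1 \<or> \<kappa> = - 1) \<and> (\<forall>x. real (hamming_weight (codeword x)) = wt (support x) (\<kappa> * char_sum x))"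
proof -
  obtain \<kappa> :: real where \<kappa>: "\<kappa> = 1 \<or> \<kappa> = - 1" and F: "\<And>y A. gcd (int ((r - 1) div (q - 1))) A = 2 \<Longrightarrow>
      real (orbit_count A y) =
        (real q - 1) / real q * (of_bool (y \<noteq> 0) * real r + \<kappa> * real_of_int (qchar y) * sqrt r)"
    using orbit_count_formula by blast
  from \<kappa> obtain k :: int where k: "k = 1 \<or> k = - 1" "\<kappa> = real_of_int k"
    by (metis of_int_1 of_int_minus)
  have "real (hamming_weight (codeword x)) = wt (support x) (k * char_sum x)" for x
  proof -
    have s4: "(\<Sum>h<4. f h) = (f 0 + f 1) + (f 2 + f 3)" for f :: "nat \<Rightarrow> real"
      by (simp add: numeral_eq_Suc)
    have "4 * real \<delta> * real (hamming_weight (codeword x)) = real (4 * \<delta> * hamming_weight (codeword x))"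
      by simp
    also have "\<dots> = (\<Sum>h<4. real (orbit_count (a * 4) (val x h)))"
      by (simp only: hamming_weight_orbit_count of_nat_sum)
    also have "\<dots> = (\<Sum>h<4. (real q - 1) / real q * (of_bool (dft x h \<noteq> 0) * real r +
        \<kappa> * real_of_int (qchar (val x h)) * sqrt r))"
      by (simp only: F[OF gcd_index] val_eq_0_iff)
    also have "\<dots> = (real q - 1) / real q * ((\<Sum>h<4. of_bool (dft x h \<noteq> 0)) * real r +
        \<kappa> * (\<Sum>h<4. real_of_int (qchar (val x h))) * sqrt r)"
      by (simp add: s4 ring_distribs)
    also have "(\<Sum>h<4. of_bool (dft x h \<noteq> 0)) = real_of_int (support x)"
      by (simp add: s4 support_def abs_qchar)
    also have "(\<Sum>h<4. real_of_int (qchar (val x h))) = real_of_int (char_sum x)"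
      by (simp add: s4 char_sum_def qchar_val)
    finally show ?thesis
      using \<delta>_pos card_gt_1 by (simp add: wt_def k(2) field_simps)
  qed
  thus ?thesis using k(1) by blast
qed

lemma dft_zero: "dft (0, 0, 0) h = 0"
  by simp

text \<open>Not all four values vanish, and since their sum is zero a single one cannot be
  nonzero.\<close>

lemma support_ge_2:
  assumes "x \<noteq> (0, 0, 0)"
  shows "support x \<ge> 2"
proof -
  have "\<exists>h<4. dft x h \<noteq> 0"
    using dft_inj[of x "(0, 0, 0)"] assms unfolding dft_zero by blast
  hence "dft x 0 \<noteq> 0 \<or> dft x 1 \<noteq> 0 \<or> dft x 2 \<noteq> 0 \<or> dft x 3 \<noteq> 0"
    by (auto simp: numeral_eq_Suc less_Suc_eq)
  thus ?thesis using dft_sum[of x] unfolding support_def abs_qchar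
    by (auto simp: of_bool_def)
qed

lemma char_sum_bound: "\<bar>char_sum x\<bar> \<le> support x"
  unfolding char_sum_def support_def by (cases "even a"; simp; linarith)

lemma sqrt_card: "sqrt r > 0" "sqrt r < r"
  using card_gt_1 by (simp_all add: real_less_lsqrt power2_eq_square)

lemma wt_ge:
  assumes "z \<ge> 2" "\<bar>c\<bar> \<le> z"
  shows "wt z c \<ge> wt 2 (- 2)"
proof -
  \<comment> \<open>In two estimates: z r + c sqrt r is at least z (r - sqrt r), which is at least 2
    (r - sqrt r).\<close>
  have "real_of_int z * sqrt r + real_of_int c * sqrt r \<ge> 0"
    using assms sqrt_card(1) by (simp flip: distrib_right)
  moreover have "(real_of_int z - 2) * (real r - sqrt r) \<ge> 0"
    using assms sqrt_card(2) by (intro mult_nonneg_nonneg) auto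
  ultimately have "real_of_int 2 * real r + real_of_int (- 2) * sqrt r \<le> real_of_int z * real r + real_of_int c * sqrt r"
    by (simp add: algebra_simps)
  thus ?thesis unfolding wt_def using card_gt_1 by (intro mult_left_mono) auto
qed

lemma wt_2_pos: "wt 2 (- 2) > 0"
  unfolding wt_def using card_gt_1 sqrt_card \<delta>_pos by (intro mult_pos_pos divide_pos_pos) auto

lemma hamming_weight_ge:
  assumes "x \<noteq> (0, 0, 0)"
  shows "real (hamming_weight (codeword x)) \<ge> wt 2 (- 2)"
proof -
  obtain \<kappa> :: int where \<kappa>: "\<kappa> = 1 \<or> \<kappa> = - 1"
    and W: "real (hamming_weight (codeword x)) = wt (support x) (\<kappa> * char_sum x)"
    using hamming_weight_formula by blast
  have "\<bar>\<kappa> * char_sum x\<bar> \<le> support x" using \<kappa> char_sum_bound[of x] by auto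
  thus ?thesis unfolding W using support_ge_2[OF assms] by (rule wt_ge[rotated])
qed

section \<open>Linearity, dimension and cyclicity\<close>

definition comb :: "'k \<Rightarrow> 'f \<times> 'f \<times> 'f \<Rightarrow> 'k \<Rightarrow> 'f \<times> 'f \<times> 'f \<Rightarrow> 'f \<times> 'f \<times> 'f" where
  "comb c x d y = (emb c * fst x + emb d * fst y, emb c * fst (snd x) + emb d * fst (snd y),
     emb c * snd (snd x) + emb d * snd (snd y))"

lemma codeword_dim [simp]: "dim_vec (codeword x) = n"
  by (simp add: codeword_def)

lemma codeword_index [simp]: "i < n \<Longrightarrow> codeword x $ i = Tr (val x i)"
  by (simp add: codeword_def)

lemma codeword_comb_index: "i < n \<Longrightarrow> codeword (comb c x d y) $ i = c * codeword x $ i + d * codeword y $ i"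
proof -
  assume "i < n"
  have "val (comb c x d y) i = emb c * val x i + emb d * val y i"
    by (cases x; cases y) (simp add: comb_def algebra_simps)
  thus ?thesis using \<open>i < n\<close> by (simp add: trace_add trace_smult)
qed

lemma hamming_distance_codeword:
  "hamming_distance (codeword x) (codeword y) = hamming_weight (codeword (comb 1 x (- 1) y))"
  unfolding hamming_distance_def hamming_weight_def
  by (rule arg_cong[of _ _ card]) (auto simp: codeword_comb_index simp del: codeword_index)

lemma comb_eq_0_iff: "comb 1 x (- 1) y = (0, 0, 0) \<longleftrightarrow> x = y"
  by (cases x; cases y) (auto simp: comb_def hom_uminus)

text \<open>The distance of two codewords is the weight belonging to the difference of their
  triples, and the weight of a nonzero triple has a positive lower bound.\<close>

lemma codeword_inj: "inj codeword"
proof (rule injI, rule ccontr)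
  fix x y assume eq: "codeword x = codeword y" and "x \<noteq> y"
  hence "comb 1 x (- 1) y \<noteq> (0, 0, 0)" by (simp add: comb_eq_0_iff)
  hence "real (hamming_distance (codeword x) (codeword y)) \<ge> wt 2 (- 2)"
    unfolding hamming_distance_codeword by (rule hamming_weight_ge)
  thus False using wt_2_pos eq by (simp add: hamming_distance_def)
qed

lemma subspace_code: "VectorSpace.subspace class_ring (range codeword) (module_vec TYPE('k) n)"
proof -
  interpret V: vec_space "TYPE('k)" n .
  have cl: "c \<cdot>\<^sub>v codeword x + d \<cdot>\<^sub>v codeword y \<in> range codeword" for c d x y
    by (rule range_eqI[of _ _ "comb c x d y"], rule eq_vecI) (simp_all add: codeword_comb_index del: codeword_index)
  show ?thesis
  proof (intro VectorSpace.subspace.intro LinearCombinations.submodule.intro)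
    show "vectorspace class_ring (module_vec TYPE('k) n)" by (rule V.vectorspace_axioms)
    show "Module.module class_ring (module_vec TYPE('k) n)" by (rule V.module_axioms)
    show "range codeword \<subseteq> carrier (module_vec TYPE('k) n)"
      by (auto simp: module_vec_simps intro!: carrier_vecI)
    show "\<zero>\<^bsub>module_vec TYPE('k) n\<^esub> \<in> range codeword"
      by (rule range_eqI[of _ _ "(0, 0, 0)"], rule eq_vecI) (simp_all add: module_vec_simps)
    show "v \<oplus>\<^bsub>module_vec TYPE('k) n\<^esub> w \<in> range codeword"
      if "v \<in> range codeword" "w \<in> range codeword" for v w
      using that cl[of 1 _ 1] by (auto simp: module_vec_simps)
    show "c \<odot>\<^bsub>module_vec TYPE('k) n\<^esub> v \<in> range codeword"
      if "c \<in> carrier class_ring" "v \<in> range codeword" for c v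
    proof -
      from that obtain x where "v = codeword x" by blast
      moreover have "c \<cdot>\<^sub>v codeword x = c \<cdot>\<^sub>v codeword x + 0 \<cdot>\<^sub>v codeword x"
        by (rule eq_vecI) simp_all
      ultimately show ?thesis using cl[of c x 0 x] by (simp add: module_vec_simps)
    qed
  qed
qed

lemma linear_code_codewords: "linear_code n (3 * m) (range codeword)"
proof -
  let ?d = "vectorspace.dim class_ring ((module_vec TYPE('k) n)\<lparr>carrier := range codeword\<rparr>)"
  have "q ^ ?d = card (range codeword)"
    using card_eq_power_dim[OF _ subspace_code] by (simp add: card_base)
  also have "\<dots> = r * (r * r)"
    using codeword_inj by (simp add: card_image card_ext UNIV_Times_UNIV[symmetric] card_cartesian_product del: UNIV_Times_UNIV)
  also have "\<dots> = q ^ (m + (m + m))" by (simp only: r_eq power_add)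
  also have "m + (m + m) = 3 * m" by simp
  finally have "?d = 3 * m" using card_gt_1 by (simp add: power_inject_exp)
  thus ?thesis unfolding linear_code_def using subspace_code by blast
qed

lemma cyclic_code_codewords: "cyclic_code n (3 * m) (range codeword)"
proof -
  have "vec n (\<lambda>i. codeword x $ ((i + n - 1) mod n)) \<in> range codeword" for x
  proof -
    obtain x1 x2 x3 where x: "x = (x1, x2, x3)" by (cases x)
    \<comment> \<open>Moving the index back by one multiplies the j-th term by \<gamma>^(- b_j),
      which the coefficient absorbs; the n in \<open>i + n - 1\<close> is a full period.\<close>
    define y where "y = (x1 * \<gamma> powi (- b 1), x2 * \<gamma> powi (- b 2), x3 * \<gamma> powi (- b 3))"
    have "\<gamma> powi (b j * int (i + n - 1)) = \<gamma> powi (- b j) * \<gamma> powi (b j * int i)" if "j \<in> {1..3}" for i j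
    proof -
      have "b j * int (i + n - 1) = - b j + b j * int i + b j * int n"
        using n_pos by (simp add: of_nat_diff algebra_simps)
      hence "\<gamma> powi (b j * int (i + n - 1)) = \<gamma> powi (- b j) * \<gamma> powi (b j * int i) * \<gamma> powi (b j * int n)"
        by (simp only: power_int_add gamma_nonzero not_False_eq_True simp_thms)
      thus ?thesis using powi_b_n[OF that] by simp
    qed
    hence "val y i = val x ((i + n - 1) mod n)" for i
      unfolding val_mod by (simp add: x y_def mult.assoc)
    hence "vec n (\<lambda>i. codeword x $ ((i + n - 1) mod n)) = codeword y"
      using n_pos by (intro eq_vecI) auto
    thus ?thesis by blast
  qed
  thus ?thesis unfolding cyclic_code_def using linear_code_codewords by blast
qed

section \<open>Weight distribution and minimum distance\<close>

lemma card_weight: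
  "\<exists>\<kappa>::int. (\<kappa> = 1 \<or> \<kappa> = - 1) \<and> (\<forall>w.
     real (card {c \<in> range codeword. real (hamming_weight c) = w}) =
       quad_sum r (\<lambda>\<alpha> \<beta> \<alpha>' \<beta>'. of_bool (wt ((\<bar>\<alpha>\<bar> + \<bar>\<beta>\<bar>) + (\<bar>\<alpha>'\<bar> + \<bar>\<beta>'\<bar>))
         (\<kappa> * (if even a then (\<alpha> + \<beta>) + (\<alpha>' + \<beta>') else (\<alpha> - \<beta>) + (\<alpha>' - \<beta>'))) = w)))"
proof -
  obtain \<kappa> :: int where \<kappa>: "\<kappa> = 1 \<or> \<kappa> = - 1"
    and W: "\<And>x. real (hamming_weight (codeword x)) = wt (support x) (\<kappa> * char_sum x)"
    using hamming_weight_formula by blast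
  have "real (card {c \<in> range codeword. real (hamming_weight c) = w}) =
      (\<Sum>x\<in>UNIV. of_bool (wt (support x) (\<kappa> * char_sum x) = w))" for w
  proof -
    have "{c \<in> range codeword. real (hamming_weight c) = w} =
        codeword ` {x. wt (support x) (\<kappa> * char_sum x) = w}" by (auto simp: W)
    thus ?thesis
      using codeword_inj by (simp add: card_image inj_on_subset of_bool_def sum.If_cases)
  qed
  \<comment> \<open>The indicator depends on the triple only through the classes of its four
    transform values, so \<open>sum_dft\<close> turns the count into a
    \<open>quad_sum\<close>.\<close>
  thus ?thesis
    using \<kappa> unfolding sum_dft[symmetric] support_def char_sum_def by blast
qed

end

text \<open>The weight of an actual codeword has positive frequency and must therefore occur in the
  table.\<close>

lemma weight_distribution_weights:
  assumes "finite C" "weight_distribution C ((0, f) # tbl)"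
  shows "card (hamming_weight ` C - {0}) \<le> length tbl"
proof -
  have "real (hamming_weight c) \<in> fst ` set ((0, f) # tbl)" if "c \<in> C" for c
  proof (rule ccontr)
    let ?w = "real (hamming_weight c)"
    assume "?w \<notin> fst ` set ((0, f) # tbl)"
    hence zero: "(\<Sum>(w', f)\<leftarrow>(0, f) # tbl. if w' = ?w then f else 0) = (\<Sum>_\<leftarrow>(0, f) # tbl. 0)"
      by (intro arg_cong[of _ _ sum_list] map_cong) (auto simp: image_iff split: prod.splits)
    have "real (card {c' \<in> C. real (hamming_weight c') = ?w}) =
        (\<Sum>(w', f)\<leftarrow>(0, f) # tbl. if w' = ?w then f else 0)"
      using assms(2) unfolding weight_distribution_def by (rule spec)
    also have "\<dots> = 0" unfolding zero by (simp add: sum_list_triv)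
    finally have "card {c' \<in> C. real (hamming_weight c') = ?w} = 0" by simp
    thus False using that assms(1) by auto
  qed
  hence "real ` (hamming_weight ` C - {0}) \<subseteq> fst ` set tbl" by auto
  hence "card (real ` (hamming_weight ` C - {0})) \<le> card (fst ` set tbl)"
    by (rule card_mono[rotated]) simp
  also have "\<dots> \<le> length tbl"
    using card_image_le[of "set tbl" fst] card_length[of tbl] by simp
  finally show ?thesis by (simp add: card_image inj_on_def)
qed

text \<open>Coinciding weights have their frequencies added, so a positive entry guarantees a
  codeword once no other entry can cancel it.\<close>

lemma weight_distribution_attained:
  assumes D: "weight_distribution C tbl" and mem: "(w, f) \<in> set tbl" "f > 0"
    and nonneg: "list_all (\<lambda>x. snd x \<ge> 0) tbl"
  shows "\<exists>c\<in>C. real (hamming_weight c) = w"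
proof -
  let ?g = "\<lambda>(w', f'). if w' = w then f' else (0::real)"
  obtain xs ys where tbl: "tbl = xs @ (w, f) # ys" using mem by (meson split_list)
  have "?g x \<ge> 0" if "x \<in> set xs \<union> set ys" for x
    using nonneg that by (cases x) (force simp: tbl list_all_iff)
  hence "sum_list (map ?g xs) \<ge> 0" "sum_list (map ?g ys) \<ge> 0"
    by (auto intro!: sum_list_nonneg)
  hence "sum_list (map ?g tbl) > 0" using mem(2) by (simp add: tbl)
  moreover have "real (card {c \<in> C. real (hamming_weight c) = w}) = sum_list (map ?g tbl)"
    using D unfolding weight_distribution_def by (rule spec)
  ultimately have "card {c \<in> C. real (hamming_weight c) = w} \<noteq> 0" by linarith
  hence "{c \<in> C. real (hamming_weight c) = w} \<noteq> {}" by (metis card.empty)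
  thus ?thesis by blast
qed

context three_term_code
begin

text \<open>The dictionary between the listed weights and \<open>wt\<close>. The first equation is
  left out when the tables are unfolded, because its left side 0 also occurs there as the frequency
  of a non-matching entry.\<close>

lemma wt_eqs:
  "0 = wt 0 0"
  "(real q - 1) / (2 * \<delta> * q) * (r + sqrt r) = wt 2 2"
  "(real q - 1) / (2 * \<delta> * q) * (r - sqrt r) = wt 2 (- 2)"
  "(real q - 1) / (2 * \<delta> * q) * r = wt 2 0"
  "3 * (real q - 1) / (4 * \<delta> * q) * (r + sqrt r) = wt 3 3"
  "3 * (real q - 1) / (4 * \<delta> * q) * (r - sqrt r) = wt 3 (- 3)"
  "(real q - 1) / (4 * \<delta> * q) * (3 * r + sqrt r) = wt 3 1"
  "(real q - 1) / (4 * \<delta> * q) * (3 * r - sqrt r) = wt 3 (- 1)"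
  "(real q - 1) / (\<delta> * q) * (r + sqrt r) = wt 4 4"
  "(real q - 1) / (\<delta> * q) * (r - sqrt r) = wt 4 (- 4)"
  "(real q - 1) / (2 * \<delta> * q) * (2 * r + sqrt r) = wt 4 2"
  "(real q - 1) / (2 * \<delta> * q) * (2 * r - sqrt r) = wt 4 (- 2)"
  "(real q - 1) / (\<delta> * q) * r = wt 4 0"
  using \<delta>_pos card_gt_1 by (simp_all add: wt_def field_simps)

lemma weight_distribution_even:
  assumes "even a"
  shows "weight_distribution (range codeword)
      [(0, 1),
       ((real q - 1) / (2 * \<delta> * q) * (r + sqrt r), 3 * (real r - 1)),
       ((real q - 1) / (2 * \<delta> * q) * (r - sqrt r), 3 * (real r - 1)),
       (3 * (real q - 1) / (4 * \<delta> * q) * (r + sqrt r), (real r - 1) * (real r - 5) / 2),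
       (3 * (real q - 1) / (4 * \<delta> * q) * (r - sqrt r), (real r - 1) * (real r - 5) / 2),
       ((real q - 1) / (4 * \<delta> * q) * (3 * r + sqrt r), 3 * (real r - 1)\<^sup>2 / 2),
       ((real q - 1) / (4 * \<delta> * q) * (3 * r - sqrt r), 3 * (real r - 1)\<^sup>2 / 2),
       ((real q - 1) / (\<delta> * q) * (r + sqrt r), (real r - 1) * ((real r)\<^sup>2 - 2 * real r + 9) / 16),
       ((real q - 1) / (\<delta> * q) * (r - sqrt r), (real r - 1) * ((real r)\<^sup>2 - 2 * real r + 9) / 16),
       ((real q - 1) / (2 * \<delta> * q) * (2 * r + sqrt r), (real r - 1) * ((real r)\<^sup>2 - 4 * real r + 3) / 4),
       ((real q - 1) / (2 * \<delta> * q) * (2 * r - sqrt r), (real r - 1) * ((real r)\<^sup>2 - 4 * real r + 3) / 4),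
       ((real q - 1) / (\<delta> * q) * r, 3 * (real r - 1) ^ 3 / 8)]"
  unfolding weight_distribution_def wt_eqs(2-)
proof (intro allI, goal_cases)
  case (1 w)
  obtain \<kappa> :: int where \<kappa>: "\<kappa> = 1 \<or> \<kappa> = - 1" and
    "real (card {c \<in> range codeword. real (hamming_weight c) = w}) =
       quad_sum r (\<lambda>\<alpha> \<beta> \<alpha>' \<beta>'. of_bool (wt ((\<bar>\<alpha>\<bar> + \<bar>\<beta>\<bar>) + (\<bar>\<alpha>'\<bar> + \<bar>\<beta>'\<bar>))
         (\<kappa> * ((\<alpha> + \<beta>) + (\<alpha>' + \<beta>'))) = w))"
    using card_weight assms by auto
  note eq = this(2)[unfolded quad_sum_even[where f = "\<lambda>z c. of_bool (wt z (\<kappa> * c) = w)"]]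
  have o: "(if c then f else 0) = f * of_bool c" for c and f :: real by simp
  \<comment> \<open>The sign \<kappa> = -1 only exchanges weights with opposite second argument of
    \<open>wt\<close>, and these have equal frequencies.\<close>
  show ?case
    unfolding eq o using \<kappa> wt_eqs(1)
    by (elim disjE) (simp_all only: list.map sum_list.Cons sum_list.Nil prod.case distrib_left mult_1 mult_minus_left
      distrib_right minus_minus mult_zero_left mult_zero_right minus_zero add_0_left add_0_right ac_simps)
qed

lemma weight_distribution_odd:
  assumes "odd a"
  shows "weight_distribution (range codeword)
      [(0, 1),
       ((real q - 1) / (2 * \<delta> * q) * (r + sqrt r), real r - 1),
       ((real q - 1) / (2 * \<delta> * q) * (r - sqrt r), real r - 1),
       ((real q - 1) / (2 * \<delta> * q) * r, 4 * (real r - 1)),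
       (3 * (real q - 1) / (4 * \<delta> * q) * (r + sqrt r), (real r - 1)\<^sup>2 / 2),
       (3 * (real q - 1) / (4 * \<delta> * q) * (r - sqrt r), (real r - 1)\<^sup>2 / 2),
       ((real q - 1) / (4 * \<delta> * q) * (3 * r + sqrt r), (real r - 1) * (3 * real r - 7) / 2),
       ((real q - 1) / (4 * \<delta> * q) * (3 * r - sqrt r), (real r - 1) * (3 * real r - 7) / 2),
       ((real q - 1) / (\<delta> * q) * (r + sqrt r), (real r - 1) ^ 3 / 16),
       ((real q - 1) / (\<delta> * q) * (r - sqrt r), (real r - 1) ^ 3 / 16),
       ((real q - 1) / (2 * \<delta> * q) * (2 * r + sqrt r), (real r - 1) * ((real r)\<^sup>2 - 4 * real r + 3) / 4),
       ((real q - 1) / (2 * \<delta> * q) * (2 * r - sqrt r), (real r - 1) * ((real r)\<^sup>2 - 4 * real r + 3) / 4),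
       ((real q - 1) / (\<delta> * q) * r, (real r - 1) * (3 * (real r)\<^sup>2 - 6 * real r + 11) / 8)]"
  unfolding weight_distribution_def wt_eqs(2-)
proof (intro allI, goal_cases)
  case (1 w)
  obtain \<kappa> :: int where \<kappa>: "\<kappa> = 1 \<or> \<kappa> = - 1" and
    "real (card {c \<in> range codeword. real (hamming_weight c) = w}) =
       quad_sum r (\<lambda>\<alpha> \<beta> \<alpha>' \<beta>'. of_bool (wt ((\<bar>\<alpha>\<bar> + \<bar>\<beta>\<bar>) + (\<bar>\<alpha>'\<bar> + \<bar>\<beta>'\<bar>))
         (\<kappa> * ((\<alpha> - \<beta>) + (\<alpha>' - \<beta>'))) = w))"
    using card_weight assms by auto
  note eq = this(2)[unfolded quad_sum_odd[where f = "\<lambda>z c. of_bool (wt z (\<kappa> * c) = w)"]]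
  have o: "(if c then f else 0) = f * of_bool c" for c and f :: real by simp
  show ?case
    unfolding eq o using \<kappa> wt_eqs(1)
    by (elim disjE) (simp_all only: list.map sum_list.Cons sum_list.Nil prod.case distrib_left mult_1 mult_minus_left
      distrib_right minus_minus mult_zero_left mult_zero_right minus_zero add_0_left add_0_right ac_simps)
qed

lemma weight_2_attained: "\<exists>c\<in>range codeword. real (hamming_weight c) = wt 2 (- 2)"
proof -
  \<comment> \<open>From r > 1 and r \<equiv> 1 (mod 8). The bound makes all listed frequencies
    nonnegative, for instance (r - 1)(r - 5)/2.\<close>
  have r9: "real r \<ge> 9"
  proof -
    obtain j where "r - 1 = 8 * j" using eight_dvd by blast
    hence "r \<ge> 9" using card_gt_1 by (cases j) auto
    thus ?thesis by simp
  qed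
  have nonneg: "real r ^ 2 - 2 * real r + 9 \<ge> 0" "real r ^ 2 - 4 * real r + 3 \<ge> 0" "3 * real r ^ 2 - 6 * real r + 11 \<ge> 0"
    using r9 mult_left_mono[OF r9, of "real r"] by (simp_all add: power2_eq_square)
  show ?thesis
  proof (cases "even a")
    case True
    show ?thesis
      by (rule weight_distribution_attained[OF weight_distribution_even[OF True, unfolded wt_eqs(2-)], where f = "3 * (real r - 1)"])
         (use r9 nonneg in \<open>simp_all add: zero_le_mult_iff\<close>)
  next
    case False
    show ?thesis
      by (rule weight_distribution_attained[OF weight_distribution_odd[OF False, unfolded wt_eqs(2-)], where f = "real r - 1"])
         (use r9 nonneg in \<open>simp_all add: zero_le_mult_iff\<close>)
  qed
qed

text \<open>Distances of distinct codewords are weights of nonzero triples, and the smallest such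
  weight is realised as a distance to the zero word.\<close>

lemma min_distance_eq: "real (min_distance (range codeword)) = wt 2 (- 2)"
proof -
  define D where "D = {hamming_distance u v | u v. u \<in> range codeword \<and> v \<in> range codeword \<and> u \<noteq> v}"
  have lower: "real d \<ge> wt 2 (- 2)" if "d \<in> D" for d
  proof -
    from that obtain x y where d: "d = hamming_distance (codeword x) (codeword y)" and "codeword x \<noteq> codeword y"
      unfolding D_def by blast
    hence "comb 1 x (- 1) y \<noteq> (0, 0, 0)" by (auto simp only: comb_eq_0_iff)
    thus ?thesis unfolding d hamming_distance_codeword by (rule hamming_weight_ge)
  qed
  obtain x where x: "real (hamming_weight (codeword x)) = wt 2 (- 2)" using weight_2_attained by blast
  have cz: "codeword (0, 0, 0) $ i = 0" if "i < n" for i using that by simp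
  have "hamming_weight (codeword (0, 0, 0)) = 0"
    unfolding hamming_weight_def using cz by auto
  hence "codeword x \<noteq> codeword (0, 0, 0)" using x wt_2_pos by auto
  moreover have "hamming_distance (codeword x) (codeword (0, 0, 0)) = hamming_weight (codeword x)"
    unfolding hamming_distance_def hamming_weight_def
    by (rule arg_cong[of _ _ card]) (auto simp: cz simp del: codeword_index)
  ultimately have mem: "hamming_weight (codeword x) \<in> D" unfolding D_def by (metis (mono_tags, lifting) mem_Collect_eq rangeI)
  have "D \<subseteq> (\<lambda>(u, v). hamming_distance u v) ` (range codeword \<times> range codeword)"
    by (auto simp: D_def)
  hence "finite D" by (rule finite_subset) simp
  have "Min D = hamming_weight (codeword x)"
  proof (rule Min_eqI)
    show "hamming_weight (codeword x) \<le> d" if "d \<in> D" for d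
      using lower[OF that] unfolding x[symmetric] by simp
  qed fact+
  thus ?thesis unfolding min_distance_def D_def[symmetric] by (simp add: x)
qed

lemma card_weights: "card (hamming_weight ` range codeword - {0}) \<le> 12"
proof (cases "even a")
  case True
  show ?thesis using weight_distribution_weights[OF _ weight_distribution_even[OF True]] by simp
next
  case False
  show ?thesis using weight_distribution_weights[OF _ weight_distribution_odd[OF False]] by simp
qed

end

theorem theorem2:
  fixes emb :: "'k::{field,finite} \<Rightarrow> 'f::{field,finite}"
    and p s m q r e t N \<delta> n :: nat
    and \<gamma> :: 'f
    and a :: int
    and \<Delta> b :: "nat \<Rightarrow> int"
    and C :: "'k vec set"
  assumes "prime p" and "s \<ge> 1" and "m \<ge> 1"
    and "q = p ^ s" and "r = q ^ m"
    and "CARD('k) = q" and "CARD('f) = r" and "field_hom emb"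
    and "range (\<lambda>k::int. \<gamma> powi k) = UNIV - {0}"
    and "e \<ge> t" and "t \<ge> 2" and "e dvd r - 1"
    and "\<not> [a = 0] (mod int (r - 1))"
    and "\<forall>i\<in>{1..t}. \<forall>j\<in>{1..t}. i \<noteq> j \<longrightarrow> \<not> [\<Delta> i = \<Delta> j] (mod int e)"
    and "Gcd (insert (int e) ((\<lambda>i. \<Delta> i - \<Delta> 1) ` {2..t})) = 1"
    and "\<forall>i\<in>{1..t}. [b i = a + int ((r - 1) div e) * \<Delta> i] (mod int (r - 1))"
    and "\<forall>i\<in>{1..t}. degree (min_poly emb (\<gamma> powi (- b i))) = m"
    and "\<forall>i\<in>{1..t}. \<forall>j\<in>{1..t}. i \<noteq> j \<longrightarrow>
           min_poly emb (\<gamma> powi (- b i)) \<noteq> min_poly emb (\<gamma> powi (- b j))"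
    and "N = nat (gcd (int ((r - 1) div (q - 1))) (a * int e))"
    and "\<delta> = nat (Gcd (insert (int (r - 1)) (b ` {1..t})))"
    and "n = (r - 1) div \<delta>"
    and "C = trace_code emb m \<gamma> n t b"
    and "N = 2" and "t = e - 1" and "t = 3"
  shows "cyclic_code n (3 * m) C \<and>
    real (min_distance C) = (real q - 1) * (real r - sqrt r) / (2 * real q * real \<delta>) \<and>
    card (hamming_weight ` C - {0}) \<le> 12 \<and>
    (2 dvd a \<longrightarrow> weight_distribution C
      [(0, 1),
       ((real q - 1) / (2 * \<delta> * q) * (r + sqrt r), 3 * (real r - 1)),
       ((real q - 1) / (2 * \<delta> * q) * (r - sqrt r), 3 * (real r - 1)),
       (3 * (real q - 1) / (4 * \<delta> * q) * (r + sqrt r), (real r - 1) * (real r - 5) / 2),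
       (3 * (real q - 1) / (4 * \<delta> * q) * (r - sqrt r), (real r - 1) * (real r - 5) / 2),
       ((real q - 1) / (4 * \<delta> * q) * (3 * r + sqrt r), 3 * (real r - 1)\<^sup>2 / 2),
       ((real q - 1) / (4 * \<delta> * q) * (3 * r - sqrt r), 3 * (real r - 1)\<^sup>2 / 2),
       ((real q - 1) / (\<delta> * q) * (r + sqrt r), (real r - 1) * ((real r)\<^sup>2 - 2 * real r + 9) / 16),
       ((real q - 1) / (\<delta> * q) * (r - sqrt r), (real r - 1) * ((real r)\<^sup>2 - 2 * real r + 9) / 16),
       ((real q - 1) / (2 * \<delta> * q) * (2 * r + sqrt r), (real r - 1) * ((real r)\<^sup>2 - 4 * real r + 3) / 4),
       ((real q - 1) / (2 * \<delta> * q) * (2 * r - sqrt r), (real r - 1) * ((real r)\<^sup>2 - 4 * real r + 3) / 4),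
       ((real q - 1) / (\<delta> * q) * r, 3 * (real r - 1) ^ 3 / 8)]) \<and>
    (\<not> 2 dvd a \<longrightarrow> weight_distribution C
      [(0, 1),
       ((real q - 1) / (2 * \<delta> * q) * (r + sqrt r), real r - 1),
       ((real q - 1) / (2 * \<delta> * q) * (r - sqrt r), real r - 1),
       ((real q - 1) / (2 * \<delta> * q) * r, 4 * (real r - 1)),
       (3 * (real q - 1) / (4 * \<delta> * q) * (r + sqrt r), (real r - 1)\<^sup>2 / 2),
       (3 * (real q - 1) / (4 * \<delta> * q) * (r - sqrt r), (real r - 1)\<^sup>2 / 2),
       ((real q - 1) / (4 * \<delta> * q) * (3 * r + sqrt r), (real r - 1) * (3 * real r - 7) / 2),
       ((real q - 1) / (4 * \<delta> * q) * (3 * r - sqrt r), (real r - 1) * (3 * real r - 7) / 2),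
       ((real q - 1) / (\<delta> * q) * (r + sqrt r), (real r - 1) ^ 3 / 16),
       ((real q - 1) / (\<delta> * q) * (r - sqrt r), (real r - 1) ^ 3 / 16),
       ((real q - 1) / (2 * \<delta> * q) * (2 * r + sqrt r), (real r - 1) * ((real r)\<^sup>2 - 4 * real r + 3) / 4),
       ((real q - 1) / (2 * \<delta> * q) * (2 * r - sqrt r), (real r - 1) * ((real r)\<^sup>2 - 4 * real r + 3) / 4),
       ((real q - 1) / (\<delta> * q) * r, (real r - 1) * (3 * (real r)\<^sup>2 - 6 * real r + 11) / 8)])"
proof -
  \<comment> \<open>The subtraction in t = e - 1 is truncated, but its value 3 is positive, so e is
    determined.\<close>
  have e: "e = 4" using assms(24,25) by simp
  have t: "t = 3" by fact
  have fe: "finite_extension emb p s m q r"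
    by (intro finite_extension.intro finite_extension_axioms.intro) fact+
  interpret E: finite_extension emb p s m q r by (rule fe)
  have gcd: "gcd (int ((r - 1) div (q - 1))) (a * 4) = 2"
    using assms(19, 23) by (simp add: e)
  have ev: "even ((r - 1) div (q - 1))"
    using gcd_dvd1[of "int ((r - 1) div (q - 1))" "a * 4"] unfolding gcd by simp
  have four: "4 dvd r - 1" using assms(12) by (simp add: e)
  interpret P: primitive_extension emb p s m q r \<gamma>
    using fe assms(9) four ev by (intro primitive_extension.intro primitive_extension_axioms.intro)
  have inc: "\<not> [\<Delta> i = \<Delta> j] (mod 4)" if "i \<in> {1..3}" "j \<in> {1..3}" "i \<noteq> j" for i j
    using assms(14) that by (simp add: e t)
  have bc: "[b i = a + int ((r - 1) div 4) * \<Delta> i] (mod int (r - 1))" if "i \<in> {1..3}" for i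
    using assms(16) that by (simp add: e t)
  interpret T: three_term_code emb p s m q r \<gamma> a \<Delta> b \<delta> n
    using P.primitive_extension_axioms gcd inc bc assms(20,21)
    by (intro three_term_code.intro three_term_code_axioms.intro) (auto simp: t)
  have C: "C = range T.codeword"
    using assms(22) T.trace_code_eq by (simp add: t)
  have md: "(real q - 1) * (real r - sqrt r) / (2 * real q * real \<delta>) = T.wt 2 (- 2)"
    using T.wt_eqs(3) by (simp add: ac_simps)
  show ?thesis
    unfolding C md
    using T.cyclic_code_codewords T.min_distance_eq T.card_weights T.weight_distribution_even T.weight_distribution_odd
    by blast
qed

end
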